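(* Let $k\ge 2$ be fixed, let $n$ range over multiples of $k$, and let $y\in\Theta_A$ (the true color assignment function). Let the observation be $$\mathbf{U}=\mathbf{P}(y)+\sigma\mathbf{W}_c,$$ where $\mathbf{W}_c$ is the standard $n\times n$ GUE random matrix and $\sigma$ is deterministic (possibly depending on $n$), and let $$y^A=\mathrm{argmin}_{x\in\Theta_A}\|\mathbf{U}-\mathbf{P}(x)\|_F^2 .$$ Let $n\to\infty$. (a) If there exists a constant $\delta>0$ such that $$\sigma^2<\frac{(1-\delta)\,n\left(1-\cos\frac{2\pi}{k}\right)}{2\log n},$$ then $\lim_{n\to\infty}\Pr(y^A\in\theta(y))=1$. (b) If there exists a constant $\delta>0$ such that $$\sigma^2>\frac{(1+\delta)\,n\left(1-\cos\frac{2\pi}{k}\right)}{2\log n},$$ then $\lim_{n\to\infty}\Pr(y^A\in\theta(y))=0$.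
   Context: $[n]=\{1,\dots,n\}$ and $\mathbf{i}$ is the imaginary unit. Put $d_l=\frac{2(l-1)\pi}{k}$ for $l=1,\dots,k$, so $e^{\mathbf{i}d_1},\dots,e^{\mathbf{i}d_k}$ are the $k$th roots of unity. $\Theta$ is the set of all mappings $x:[n]\to\{e^{\mathbf{i}d_1},\dots,e^{\mathbf{i}d_k}\}$, and $\Theta_A=\{x\in\Theta: |x^{-1}(e^{\mathbf{i}d_j})|=\frac nk\ \text{for all }1\le j\le k\}$. For $x\in\Theta$, $\mathbf{x}=(x(1),\dots,x(n))^t$ and $\mathbf{P}(x)=\mathbf{x}\overline{\mathbf{x}}^t$, i.e. $\mathbf{P}_{a,b}(x)=x(a)\overline{x(b)}$. Two elements $x,z\in\Theta_A$ are equivalent if there is a fixed angle $\alpha$ with $e^{\mathbf{i}\alpha}\mathbf{x}=\mathbf{z}$; $\theta(z)$ denotes the equivalence class in $\Theta_A$ containing $z$. Since $\mathbf{P}(x)$ depends only on $\theta(x)$, the minimizer $y^A$ is determined only up to equivalence. The standard GUE matrix $\mathbf{W}_c$ is the random Hermitian matrix whose diagonal entries are i.i.d. standard real Gaussians $\mathcal{N}(0,1)_{\mathbb{R}}$ and whose strictly upper triangular entries are i.i.d. standard complex Gaussians $\mathcal{N}(0,1)_{\mathbb{C}}$ (i.e. $\mathbb{E}|Z|^2=1$, with independent real and imaginary parts of variance $\tfrac12$), independent of the diagonal. $\|\cdot\|_F$ is the Frobenius norm. *)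

theory Defs
  imports "HOL-Probability.Probability"
begin

definition angle :: "nat \<Rightarrow> nat \<Rightarrow> real" where
  "angle k l = 2 * (real l - 1) * pi / real k"

definition colors :: "nat \<Rightarrow> complex set" where
  "colors k = (\<lambda>l. cis (angle k l)) ` {1..k}"

text \<open>Mappings on \<open>{1..n}\<close> are extensional functions, so that equality of mappings is
  equality in HOL.\<close>

definition Theta :: "nat \<Rightarrow> nat \<Rightarrow> (nat \<Rightarrow> complex) set" where
  "Theta n k = {1..n} \<rightarrow>\<^sub>E colors k"

definition Theta_A :: "nat \<Rightarrow> nat \<Rightarrow> (nat \<Rightarrow> complex) set" where
  "Theta_A n k =
    {x \<in> Theta n k. \<forall>j\<in>{1..k}.
       real (card {a \<in> {1..n}. x a = cis (angle k j)}) = real n / real k}"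

definition color_equiv :: "nat \<Rightarrow> (nat \<Rightarrow> complex) \<Rightarrow> (nat \<Rightarrow> complex) \<Rightarrow> bool" where
  "color_equiv n x z \<longleftrightarrow> (\<exists>\<alpha>::real. \<forall>a\<in>{1..n}. cis \<alpha> * x a = z a)"

definition theta_class :: "nat \<Rightarrow> nat \<Rightarrow> (nat \<Rightarrow> complex) \<Rightarrow> (nat \<Rightarrow> complex) set" where
  "theta_class n k z = {x \<in> Theta_A n k. color_equiv n x z}"

text \<open>As the dimension \<open>n\<close> varies, an \<open>n \<times> n\<close> matrix is a function of two indices of which
  only the values on \<open>{1..n} \<times> {1..n}\<close> are ever used.\<close>

type_synonym cmatrix = "nat \<Rightarrow> nat \<Rightarrow> complex"

definition P_mat :: "(nat \<Rightarrow> complex) \<Rightarrow> cmatrix" where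
  "P_mat x = (\<lambda>a b. x a * cnj (x b))"

definition frobenius_norm :: "nat \<Rightarrow> cmatrix \<Rightarrow> real" where
  "frobenius_norm n A = sqrt (\<Sum>a\<in>{1..n}. \<Sum>b\<in>{1..n}. (cmod (A a b))\<^sup>2)"

definition std_real_gaussian :: "'w measure \<Rightarrow> ('w \<Rightarrow> real) \<Rightarrow> bool" where
  "std_real_gaussian M X \<longleftrightarrow> distributed M lborel X (\<lambda>t. ennreal (normal_density 0 1 t))"

text \<open>The second argument of \<^const>\<open>normal_density\<close> is the standard deviation, so the real
  and imaginary parts have variance \<open>1/2\<close>.\<close>

definition std_complex_gaussian :: "'w measure \<Rightarrow> ('w \<Rightarrow> complex) \<Rightarrow> bool" where
  "std_complex_gaussian M Z \<longleftrightarrow>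
     distributed M lborel (\<lambda>\<omega>. Re (Z \<omega>)) (\<lambda>t. ennreal (normal_density 0 (sqrt (1/2)) t)) \<and>
     distributed M lborel (\<lambda>\<omega>. Im (Z \<omega>)) (\<lambda>t. ennreal (normal_density 0 (sqrt (1/2)) t)) \<and>
     prob_space.indep_var M borel (\<lambda>\<omega>. Re (Z \<omega>)) borel (\<lambda>\<omega>. Im (Z \<omega>))"

text \<open>The real diagonal entries are forced to be real-valued by the Hermitian condition for
  \<open>a = b\<close>.\<close>

definition standard_GUE :: "'w measure \<Rightarrow> nat \<Rightarrow> ('w \<Rightarrow> cmatrix) \<Rightarrow> bool" where
  "standard_GUE M n W \<longleftrightarrow>
     (\<forall>\<omega>\<in>space M. \<forall>a\<in>{1..n}. \<forall>b\<in>{1..n}. W \<omega> b a = cnj (W \<omega> a b)) \<and>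
     (\<forall>a\<in>{1..n}. std_real_gaussian M (\<lambda>\<omega>. Re (W \<omega> a a))) \<and>
     (\<forall>a\<in>{1..n}. \<forall>b\<in>{1..n}. a < b \<longrightarrow> std_complex_gaussian M (\<lambda>\<omega>. W \<omega> a b)) \<and>
     prob_space.indep_vars M (\<lambda>_. borel) (\<lambda>(a, b) \<omega>. W \<omega> a b)
       {(a, b). a \<in> {1..n} \<and> b \<in> {1..n} \<and> a \<le> b}"

definition observation :: "(nat \<Rightarrow> complex) \<Rightarrow> real \<Rightarrow> cmatrix \<Rightarrow> cmatrix" where
  "observation y \<sigma> W = (\<lambda>a b. P_mat y a b + complex_of_real \<sigma> * W a b)"

definition objective :: "nat \<Rightarrow> cmatrix \<Rightarrow> (nat \<Rightarrow> complex) \<Rightarrow> real" where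
  "objective n U x = (frobenius_norm n (\<lambda>a b. U a b - P_mat x a b))\<^sup>2"

text \<open>A version of the estimator: a random element of \<^const>\<open>Theta_A\<close> (a finite set, hence
  the counting space) that minimizes the objective at every outcome. The minimizer is not
  unique, so every such choice is admitted.\<close>

definition argmin_estimator ::
  "'w measure \<Rightarrow> nat \<Rightarrow> nat \<Rightarrow> ('w \<Rightarrow> cmatrix) \<Rightarrow> ('w \<Rightarrow> nat \<Rightarrow> complex) \<Rightarrow> bool" where
  "argmin_estimator M n k U yA \<longleftrightarrow>
     yA \<in> measurable M (count_space (Theta_A n k)) \<and>
     (\<forall>\<omega>\<in>space M. is_arg_min (objective n (U \<omega>)) (\<lambda>x. x \<in> Theta_A n k) (yA \<omega>))"

text \<open>The filter of \<open>n\<close> tending to infinity through the multiples of \<open>k\<close>.\<close>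

definition at_top_multiples :: "nat \<Rightarrow> nat filter" where
  "at_top_multiples k = inf at_top (principal {n. k dvd n})"

end

theory Submission
  imports Defs "HOL-Real_Asymp.Real_Asymp"
begin

text \<open>For an assignment \<open>x\<close> put \<open>A = P(x) - P(y)\<close>, let \<open>q\<close> be the sum of \<open>|A\<^sub>a\<^sub>b|\<^sup>2\<close> over \<open>a < b\<close> and \<open>L\<close>
  the sum of \<open>Re (cnj A\<^sub>a\<^sub>b W\<^sub>a\<^sub>b)\<close> over \<open>a < b\<close>. The objective at \<open>x\<close> exceeds the one at \<open>y\<close> by
  \<open>2 q - 4 \<sigma> L\<close>, where \<open>L\<close> is a centred Gaussian of variance \<open>q / 2\<close>. Write \<open>c = 1 - cos (2\<pi>/k)\<close>.

  Below the threshold, Chernoff's bound shows that \<open>x\<close> beats \<open>y\<close> with probability at most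
  \<open>exp (- q / 4s)\<close> whenever \<open>\<sigma>\<^sup>2 \<le> s\<close>. Rotating \<open>x\<close> so that it agrees with \<open>y\<close> as often as possible,
  \<open>m\<close> mismatches force \<open>q \<ge> 2 c m (n - m)\<close> and \<open>q \<ge> c n m\<close>. The first estimate makes the
  contribution of small \<open>m\<close> to the union bound a binomial sum \<open>(1 + (k - 1) g)\<^sup>n - 1\<close> with
  \<open>g\<close> a power of \<open>n\<close> below \<open>1/n\<close>; the second one beats the crude count \<open>k\<^sup>n\<close> for large \<open>m\<close>.

  Above the threshold, some swap of the colors of two vertices beats \<open>y\<close>. Take about
  \<open>n / (k ln n)\<close> candidates in each of two neighbouring color classes. Up to a remainder of small
  variance, \<open>L\<close> for the swap of \<open>a\<close> and \<open>b\<close> is a sum \<open>G\<^sub>a + G\<^sub>b\<close> of Gaussians of variance about \<open>c n\<close>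
  that are independent within each class, and the maximum over each class is close to
  \<open>sqrt (2 c n ln n)\<close>, while \<open>q \<le> 4 c n\<close>.\<close>

section \<open>Linear forms in complex Gaussians\<close>

text \<open>Completing the square: tilting a centred normal density by the exponential shifts its
  mean by the variance. The remaining factor is the moment generating function at 1.\<close>

lemma exp_times_normal_density:
  fixes s x :: real
  assumes "0 < s"
  shows "exp x * normal_density 0 s x = exp (s\<^sup>2 / 2) * normal_density (s\<^sup>2) s x"
proof -
  have "x + - (x\<^sup>2) / (2 * s\<^sup>2) = s\<^sup>2 / 2 + - ((x - s\<^sup>2)\<^sup>2) / (2 * s\<^sup>2)"
    using assms by (simp add: field_simps power2_eq_square)
  hence "exp x * exp (- (x\<^sup>2) / (2 * s\<^sup>2)) = exp (s\<^sup>2 / 2) * exp (- ((x - s\<^sup>2)\<^sup>2) / (2 * s\<^sup>2))"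
    by (simp flip: exp_add)
  thus ?thesis by (simp add: normal_density_def)
qed

lemma (in prob_space) normal_exp_expectation:
  assumes X: "distributed M lborel X (normal_density 0 s)" and s: "0 < s"
  shows "integrable M (\<lambda>\<omega>. exp (X \<omega>))" and "expectation (\<lambda>\<omega>. exp (X \<omega>)) = exp (s\<^sup>2 / 2)"
proof -
  have eq: "normal_density 0 s x * exp x = exp (s\<^sup>2 / 2) * normal_density (s\<^sup>2) s x" for x
    using exp_times_normal_density[OF s, of x] by (simp add: mult.commute)
  show "integrable M (\<lambda>\<omega>. exp (X \<omega>))"
    using distributed_integrable[OF X, of exp] s by (simp add: eq integrable_normal_density)
  show "expectation (\<lambda>\<omega>. exp (X \<omega>)) = exp (s\<^sup>2 / 2)"
    using distributed_integral[OF X, of exp] s by (simp add: eq integral_normal_density)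
qed

text \<open>On [u, u+1] the density is at least its value at u+1. Compared with exp (-u^2/2) this
  loses a factor exp (-u - 1/2), which is subpolynomial in n when u is of order sqrt (ln n).\<close>

lemma (in prob_space) std_normal_tail_lower:
  assumes X: "distributed M lborel X std_normal_density" and u: "0 \<le> u"
  shows "exp (- (u + 1)\<^sup>2 / 2) / sqrt (2 * pi) \<le> \<P>(\<omega> in M. u \<le> X \<omega>)"
proof -
  have [measurable]: "X \<in> borel_measurable M"
    using distributed_measurable[OF X] by simp
  have "ennreal (exp (- (u + 1)\<^sup>2 / 2) / sqrt (2 * pi))
      = (\<integral>\<^sup>+x. ennreal (exp (- (u + 1)\<^sup>2 / 2) / sqrt (2 * pi)) * indicator {u..u+1} x \<partial>lborel)"
    using u by (simp add: nn_integral_cmult)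
  also have "\<dots> \<le> (\<integral>\<^sup>+x. ennreal (std_normal_density x) * indicator {u..} x \<partial>lborel)"
  proof (rule nn_integral_mono)
    fix x
    have "exp (- (u + 1)\<^sup>2 / 2) / sqrt (2 * pi) \<le> std_normal_density x" if "x \<in> {u..u+1}"
    proof -
      have "x\<^sup>2 \<le> (u + 1)\<^sup>2" using that u by (intro power_mono) auto
      thus ?thesis by (simp add: std_normal_density_def divide_right_mono)
    qed
    thus "ennreal (exp (- (u + 1)\<^sup>2 / 2) / sqrt (2 * pi)) * indicator {u..u+1} x
       \<le> ennreal (std_normal_density x) * indicator {u..} x"
      by (auto simp: indicator_def intro: ennreal_leI)
  qed
  also have "\<dots> = emeasure M (X -` {u..} \<inter> space M)"
    using X by (subst distributed_emeasure[OF X]) auto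
  also have "X -` {u..} \<inter> space M = {\<omega> \<in> space M. u \<le> X \<omega>}" by auto
  finally show ?thesis by (simp add: emeasure_eq_measure)
qed

locale complex_gaussian_family = prob_space M for M :: "'w measure" +
  fixes I :: "'i set" and Z :: "'i \<Rightarrow> 'w \<Rightarrow> complex"
  assumes finite_index: "finite I"
    and indep: "indep_vars (\<lambda>_. borel) Z I"
    and gaussian: "\<And>i. i \<in> I \<Longrightarrow> std_complex_gaussian M (Z i)"
begin

text \<open>The real inner product of the coefficients with the Gaussian vector. Its variance is
  half the sum of the squared moduli of the coefficients over \<open>J\<close>.\<close>

definition lin :: "('i \<Rightarrow> complex) \<Rightarrow> 'i set \<Rightarrow> 'w \<Rightarrow> real" where
  "lin A J \<omega> = (\<Sum>i\<in>J. Re (cnj (A i) * Z i \<omega>))"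

lemma lin_scaleR: "lin (\<lambda>i. of_real t * A i) J \<omega> = t * lin A J \<omega>"
  by (simp add: lin_def sum_distrib_left algebra_simps)

lemma lin_uminus: "lin (\<lambda>i. - A i) J \<omega> = - lin A J \<omega>"
  using lin_scaleR[of "- 1"] by simp

lemma Z_measurable: "i \<in> I \<Longrightarrow> Z i \<in> borel_measurable M"
  using indep by (auto simp: indep_vars_def)

lemma lin_measurable [measurable]:
  assumes "J \<subseteq> I"
  shows "lin A J \<in> borel_measurable M"
proof -
  have "(\<lambda>\<omega>. \<Sum>i\<in>J. Re (cnj (A i) * Z i \<omega>)) \<in> borel_measurable M"
    using Z_measurable assms
    by (intro borel_measurable_sum measurable_compose[OF _ borel_measurable_Re] borel_measurable_times) auto
  thus ?thesis unfolding lin_def[abs_def] .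
qed

lemma lin_singleton_distributed:
  assumes i: "i \<in> I" and A: "A \<noteq> 0"
  shows "distributed M lborel (\<lambda>\<omega>. Re (cnj A * Z i \<omega>)) (normal_density 0 (cmod A * sqrt (1/2)))"
proof -
  define s :: real where "s = sqrt (1/2)"
  have s: "0 < s" by (simp add: s_def)
  have re: "distributed M lborel (\<lambda>\<omega>. Re (Z i \<omega>)) (normal_density 0 s)"
    and im: "distributed M lborel (\<lambda>\<omega>. Im (Z i \<omega>)) (normal_density 0 s)"
    and ind: "indep_var borel (\<lambda>\<omega>. Re (Z i \<omega>)) borel (\<lambda>\<omega>. Im (Z i \<omega>))"
    using gaussian[OF i] by (auto simp: std_complex_gaussian_def s_def)
  have eq: "Re (cnj A * Z i \<omega>) = Re A * Re (Z i \<omega>) + Im A * Im (Z i \<omega>)" for \<omega> by simp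
  have re': "distributed M lborel (\<lambda>\<omega>. Re A * Re (Z i \<omega>)) (normal_density 0 (\<bar>Re A\<bar> * s))" if "Re A \<noteq> 0"
    using normal_density_affine[OF re s that, of 0] by simp
  have im': "distributed M lborel (\<lambda>\<omega>. Im A * Im (Z i \<omega>)) (normal_density 0 (\<bar>Im A\<bar> * s))" if "Im A \<noteq> 0"
    using normal_density_affine[OF im s that, of 0] by simp
  \<comment> \<open>A vanishing coefficient gives the constant 0, which has no density, so only
    nonzero coordinates can be combined as independent normals.\<close>
  consider "Re A = 0" "Im A \<noteq> 0" | "Re A \<noteq> 0" "Im A = 0" | "Re A \<noteq> 0" "Im A \<noteq> 0"
    using A by (auto simp: complex_eq_iff)
  thus ?thesis
  proof cases
    case 1
    thus ?thesis using im' by (simp add: cmod_def s_def)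
  next
    case 2
    thus ?thesis using re' by (simp add: cmod_def s_def)
  next
    case 3
    have ind': "indep_var borel (\<lambda>\<omega>. Re A * Re (Z i \<omega>)) borel (\<lambda>\<omega>. Im A * Im (Z i \<omega>))"
      using indep_var_compose[OF ind, of "(*) (Re A)" borel "(*) (Im A)" borel] by (simp add: o_def)
    have "(\<bar>Re A\<bar> * s)\<^sup>2 + (\<bar>Im A\<bar> * s)\<^sup>2 = (cmod A * s)\<^sup>2"
      by (simp add: power_mult_distrib cmod_power2 algebra_simps)
    hence "sqrt ((\<bar>Re A\<bar> * s)\<^sup>2 + (\<bar>Im A\<bar> * s)\<^sup>2) = cmod A * s" using s by simp
    thus ?thesis
      using add_indep_normal[OF ind' _ _ re' im'] 3 s by (simp add: s_def)
  qed
qed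

lemma lin_distributed:
  assumes J: "J \<subseteq> I" and pos: "0 < (\<Sum>i\<in>J. (cmod (A i))\<^sup>2)"
  shows "distributed M lborel (lin A J) (normal_density 0 (sqrt ((\<Sum>i\<in>J. (cmod (A i))\<^sup>2) / 2)))"
proof -
  \<comment> \<open>Indices with coefficient 0 contribute constants without a density. They are
    removed before independent normals are summed, and \<open>pos\<close> keeps \<open>K\<close>
    nonempty.\<close>
  define K where "K = {i\<in>J. A i \<noteq> 0}"
  have finJ: "finite J" using J finite_index finite_subset by blast
  have sumK: "(\<Sum>i\<in>J. (cmod (A i))\<^sup>2) = (\<Sum>i\<in>K. (cmod (A i))\<^sup>2)"
    unfolding K_def using finJ by (intro sum.mono_neutral_right) auto
  have linK: "lin A J = (\<lambda>\<omega>. \<Sum>i\<in>K. Re (cnj (A i) * Z i \<omega>))"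
    unfolding lin_def[abs_def] K_def using finJ by (intro ext sum.mono_neutral_right) auto
  have K: "K \<noteq> {}" using pos sumK by auto
  have "indep_vars (\<lambda>_. borel) (\<lambda>i \<omega>. (\<lambda>z. Re (cnj (A i) * z)) (Z i \<omega>)) K"
    using J by (intro indep_vars_compose2[OF indep_vars_subset[OF indep]]) (auto simp: K_def)
  hence "distributed M lborel (\<lambda>\<omega>. \<Sum>i\<in>K. Re (cnj (A i) * Z i \<omega>))
     (normal_density (\<Sum>i\<in>K. 0) (sqrt (\<Sum>i\<in>K. (cmod (A i) * sqrt (1/2))\<^sup>2)))"
    using J finJ K
    by (intro sum_indep_normal lin_singleton_distributed) (auto simp: K_def)
  moreover have "(\<Sum>i\<in>K. (cmod (A i) * sqrt (1/2))\<^sup>2) = (\<Sum>i\<in>K. (cmod (A i))\<^sup>2) / 2"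
    by (simp add: power_mult_distrib sum_divide_distrib power_divide)
  ultimately show ?thesis using linK sumK by simp
qed

text \<open>A variance of S/2 gives exp (S/4). The degenerate case S = 0 is included, so that the
  tail bound derived from this also covers forms that vanish.\<close>

lemma lin_exp_expectation:
  assumes J: "J \<subseteq> I"
  shows "integrable M (\<lambda>\<omega>. exp (lin A J \<omega>))"
    and "expectation (\<lambda>\<omega>. exp (lin A J \<omega>)) = exp ((\<Sum>i\<in>J. (cmod (A i))\<^sup>2) / 4)"
proof -
  have fin: "finite J" using J finite_index finite_subset by blast
  have "integrable M (\<lambda>\<omega>. exp (lin A J \<omega>)) \<and>
      expectation (\<lambda>\<omega>. exp (lin A J \<omega>)) = exp ((\<Sum>i\<in>J. (cmod (A i))\<^sup>2) / 4)"
  proof (cases "(\<Sum>i\<in>J. (cmod (A i))\<^sup>2) = 0")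
    case True
    hence "\<forall>i\<in>J. A i = 0" using fin by (simp add: sum_nonneg_eq_0_iff)
    hence "lin A J = (\<lambda>_. 0)" by (simp add: lin_def fun_eq_iff)
    thus ?thesis using True by (simp add: prob_space)
  next
    case False
    hence pos: "0 < (\<Sum>i\<in>J. (cmod (A i))\<^sup>2)" by (simp add: sum_nonneg less_le)
    show ?thesis
      using normal_exp_expectation[OF lin_distributed[OF J pos]] pos by simp
  qed
  thus "integrable M (\<lambda>\<omega>. exp (lin A J \<omega>))"
    and "expectation (\<lambda>\<omega>. exp (lin A J \<omega>)) = exp ((\<Sum>i\<in>J. (cmod (A i))\<^sup>2) / 4)" by auto
qed

text \<open>Chernoff's bound with the parameter \<open>t\<close> left free: different callers choose
  it differently.\<close>

lemma lin_upper_tail: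
  assumes J: "J \<subseteq> I" and t: "0 \<le> t"
  shows "\<P>(\<omega> in M. r \<le> lin A J \<omega>) \<le> exp (t\<^sup>2 * (\<Sum>i\<in>J. (cmod (A i))\<^sup>2) / 4 - t * r)"
proof -
  define B where "B = (\<lambda>i. of_real t * A i)"
  have B: "lin B J \<omega> = t * lin A J \<omega>" for \<omega> unfolding B_def by (rule lin_scaleR)
  have sumB: "(\<Sum>i\<in>J. (cmod (B i))\<^sup>2) = t\<^sup>2 * (\<Sum>i\<in>J. (cmod (A i))\<^sup>2)"
    by (simp add: B_def norm_mult power_mult_distrib sum_distrib_left)
  note [measurable] = lin_measurable[OF J]
  have "\<P>(\<omega> in M. r \<le> lin A J \<omega>) \<le> \<P>(\<omega> in M. exp (t * r) \<le> exp (lin B J \<omega>))"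
    using t by (intro finite_measure_mono) (auto simp: B mult_left_mono)
  also have "\<dots> \<le> expectation (\<lambda>\<omega>. exp (lin B J \<omega>)) / exp (t * r)"
    by (intro integral_Markov_inequality_measure[where A="{}"] lin_exp_expectation J) auto
  also have "\<dots> = exp (t\<^sup>2 * (\<Sum>i\<in>J. (cmod (A i))\<^sup>2) / 4 - t * r)"
    by (simp add: lin_exp_expectation[OF J] sumB exp_diff)
  finally show ?thesis .
qed

lemma lin_lower_tail:
  assumes J: "J \<subseteq> I" and S: "0 < (\<Sum>i\<in>J. (cmod (A i))\<^sup>2)" and u: "0 \<le> u"
    and r: "r = u * sqrt ((\<Sum>i\<in>J. (cmod (A i))\<^sup>2) / 2)"
  shows "exp (- (u + 1)\<^sup>2 / 2) / sqrt (2 * pi) \<le> \<P>(\<omega> in M. r \<le> lin A J \<omega>)"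
proof -
  define s where "s = sqrt ((\<Sum>i\<in>J. (cmod (A i))\<^sup>2) / 2)"
  have s: "0 < s" using S by (simp add: s_def)
  have "distributed M lborel (\<lambda>\<omega>. (lin A J \<omega> - 0) / s) std_normal_density"
    using lin_distributed[OF J S] normal_standard_normal_convert[OF s] unfolding s_def by blast
  from std_normal_tail_lower[OF this u] s show ?thesis
    by (simp add: r flip: s_def) (simp add: field_simps)
qed

text \<open>Forms on disjoint index sets use disjoint blocks of the independent family. The events
  of staying below \<open>r\<close> are therefore independent and their probabilities
  multiply.\<close>

lemma lin_all_below:
  assumes H: "finite H" "H \<noteq> {}" and J: "\<And>a. a \<in> H \<Longrightarrow> J a \<subseteq> I" and disj: "disjoint_family_on J H"
    and p: "\<And>a. a \<in> H \<Longrightarrow> p \<le> \<P>(\<omega> in M. r \<le> lin (A a) (J a) \<omega>)"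
  shows "\<P>(\<omega> in M. \<forall>a\<in>H. lin (A a) (J a) \<omega> < r) \<le> (1 - p) ^ card H"
proof -
  have "indep_vars (\<lambda>_. borel) (\<lambda>a \<omega>. (\<lambda>f. \<Sum>i\<in>J a. Re (cnj (A a i) * f i)) (restrict (\<lambda>i. Z i \<omega>) (J a))) H"
    by (intro indep_vars_compose2[OF indep_vars_restrict[OF indep J disj]]) auto
  hence ind: "indep_vars (\<lambda>_. borel) (\<lambda>a. lin (A a) (J a)) H"
    by (simp add: lin_def[abs_def] cong: sum.cong)
  have "\<P>(\<omega> in M. \<forall>a\<in>H. lin (A a) (J a) \<omega> < r) = prob (\<Inter>a\<in>H. lin (A a) (J a) -` {..<r} \<inter> space M)"
    using H by (intro arg_cong[where f = prob]) auto
  also have "\<dots> = (\<Prod>a\<in>H. prob (lin (A a) (J a) -` {..<r} \<inter> space M))"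
    using H by (intro indep_varsD_finite[OF ind]) auto
  also have "\<dots> \<le> (\<Prod>a\<in>H. 1 - p)"
  proof (rule prod_mono, safe)
    fix a assume a: "a \<in> H"
    note [measurable] = lin_measurable[OF J[OF a]]
    have "\<P>(\<omega> in M. \<not> r \<le> lin (A a) (J a) \<omega>) = 1 - \<P>(\<omega> in M. r \<le> lin (A a) (J a) \<omega>)"
      by (rule prob_neg) measurable
    moreover have "lin (A a) (J a) -` {..<r} \<inter> space M = {\<omega>\<in>space M. \<not> r \<le> lin (A a) (J a) \<omega>}" by auto
    ultimately show "prob (lin (A a) (J a) -` {..<r} \<inter> space M) \<le> 1 - p" using p[OF a] by simp
  qed auto
  finally show ?thesis by simp
qed

end

section \<open>Energy of a competing assignment\<close>

lemma colors_eq_roots_unity: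
  assumes "k > 0"
  shows "colors k = {z. z ^ k = 1}"
proof -
  have "(\<lambda>l. cis (angle k l)) ` {1..k} = (\<lambda>j. cis (2 * pi * real j / real k)) ` {..<k}"
  proof (intro equalityI subsetI)
    fix z assume "z \<in> (\<lambda>l. cis (angle k l)) ` {1..k}"
    then obtain l where l: "l \<in> {1..k}" "z = cis (angle k l)" by auto
    have "z = cis (2 * pi * real (l - 1) / real k)"
      using l by (simp add: angle_def of_nat_diff algebra_simps)
    thus "z \<in> (\<lambda>j. cis (2 * pi * real j / real k)) ` {..<k}" using l(1)
      by (intro image_eqI[of _ _ "l - 1"]) auto
  next
    fix z assume "z \<in> (\<lambda>j. cis (2 * pi * real j / real k)) ` {..<k}"
    then obtain j where "j < k" "z = cis (2 * pi * real j / real k)" by auto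
    thus "z \<in> (\<lambda>l. cis (angle k l)) ` {1..k}"
      by (intro image_eqI[of _ _ "Suc j"]) (auto simp: angle_def algebra_simps)
  qed
  thus ?thesis
    using Complex.bij_betw_roots_unity[OF assms] by (simp add: colors_def bij_betw_def)
qed

lemma root_unity_norm: "k > 0 \<Longrightarrow> z ^ k = 1 \<Longrightarrow> cmod z = 1" for z :: complex
  using power_eq_1_iff[of "cmod z" k] by (simp flip: norm_power)

lemma unit_cnj_mult: "cmod z = 1 \<Longrightarrow> z * cnj z = 1"
  by (simp flip: complex_norm_square)

lemma norm_cis_diff_one: "(cmod (cis t - 1))\<^sup>2 = 2 * (1 - cos t)"
proof -
  have "(cmod (cis t - 1))\<^sup>2 = (cos t)\<^sup>2 + (sin t)\<^sup>2 + 1 - 2 * cos t"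
    by (simp add: cmod_power2 power2_diff)
  thus ?thesis by simp
qed

text \<open>The roots nearest to 1 lie at the angles 2 pi / k and - 2 pi / k.\<close>

lemma root_unity_dist_one:
  assumes "k > 0" "z ^ k = 1" "z \<noteq> (1 :: complex)"
  shows "2 * (1 - cos (2 * pi / real k)) \<le> (cmod (z - 1))\<^sup>2"
proof -
  have "z \<in> (\<lambda>j. cis (2 * pi * real j / real k)) ` {..<k}"
    using Complex.bij_betw_roots_unity[OF assms(1)] assms(2) by (simp add: bij_betw_def)
  then obtain j where j: "j < k" "z = cis (2 * pi * real j / real k)" by auto
  have j0: "j > 0" using j(2) assms(3) by (cases j) auto
  define t where "t = 2 * pi * real j / real k"
  have "cos t \<le> cos (2 * pi / real k)"
  proof (cases "t \<le> pi")
    case True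
    have "2 * pi / real k \<le> t" using j0 assms(1) by (simp add: t_def field_simps)
    thus ?thesis using True by (intro cos_monotone_0_pi_le) auto
  next
    \<comment> \<open>Beyond pi the cosine increases again, so the angle is reflected to 2 pi -
      t.\<close>
    case False
    have "2 * pi - t = 2 * pi * (real k - real j) / real k"
      using assms(1) by (simp add: t_def field_simps)
    moreover have "2 * pi * 1 / real k \<le> 2 * pi * (real k - real j) / real k"
      using j(1) by (intro divide_right_mono mult_left_mono) auto
    ultimately have "2 * pi / real k \<le> 2 * pi - t" by simp
    hence "cos (2 * pi - t) \<le> cos (2 * pi / real k)"
      using False by (intro cos_monotone_0_pi_le) auto
    thus ?thesis by (simp add: cos_diff)
  qed
  thus ?thesis using norm_cis_diff_one[of t] j(2) by (simp add: t_def)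
qed

lemma roots_unity_dist:
  fixes z w :: complex
  assumes k: "k > 0" and "z ^ k = 1" "w ^ k = 1" "z \<noteq> w"
  shows "2 * (1 - cos (2 * pi / real k)) \<le> (cmod (z - w))\<^sup>2"
proof -
  have w: "cmod w = 1" "w \<noteq> 0" using root_unity_norm[OF k assms(3)] by auto
  have "(z / w) ^ k = 1" "z / w \<noteq> 1" using assms w by (auto simp: power_divide)
  from root_unity_dist_one[OF k this] have "2 * (1 - cos (2 * pi / real k)) \<le> (cmod (z / w - 1))\<^sup>2" .
  also have "z / w - 1 = (z - w) / w" using w by (simp add: field_simps)
  finally show ?thesis using w by (simp add: norm_divide)
qed

section \<open>Energy and objective as sums over pairs of vertices\<close>

definition pairs :: "nat \<Rightarrow> (nat \<times> nat) set" where
  "pairs n = {(a, b). a \<in> {1..n} \<and> b \<in> {1..n} \<and> a < b}"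

definition P_diff :: "(nat \<Rightarrow> complex) \<Rightarrow> (nat \<Rightarrow> complex) \<Rightarrow> nat \<times> nat \<Rightarrow> complex" where
  "P_diff x y = (\<lambda>(a, b). P_mat x a b - P_mat y a b)"

definition energy :: "nat \<Rightarrow> (nat \<Rightarrow> complex) \<Rightarrow> (nat \<Rightarrow> complex) \<Rightarrow> real" where
  "energy n x y = (\<Sum>p\<in>pairs n. (cmod (P_diff x y p))\<^sup>2)"

lemma finite_pairs [simp]: "finite (pairs n)"
  by (rule finite_subset[of _ "{1..n} \<times> {1..n}"]) (auto simp: pairs_def)

lemma sum_symmetric:
  fixes f :: "nat \<Rightarrow> nat \<Rightarrow> real"
  assumes sym: "\<And>a b. a \<in> {1..n} \<Longrightarrow> b \<in> {1..n} \<Longrightarrow> f a b = f b a"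
    and diag: "\<And>a. a \<in> {1..n} \<Longrightarrow> f a a = 0"
  shows "(\<Sum>a\<in>{1..n}. \<Sum>b\<in>{1..n}. f a b) = 2 * (\<Sum>(a, b)\<in>pairs n. f a b)"
proof -
  let ?Q = "{(a, b). a \<in> {1..n} \<and> b \<in> {1..n} \<and> b < a}"
  let ?D = "(\<lambda>a. (a, a)) ` {1..n}"
  have split: "{1..n} \<times> {1..n} = (pairs n \<union> ?Q) \<union> ?D" by (auto simp: pairs_def)
  have fin: "finite ?Q" by (rule finite_subset[of _ "{1..n} \<times> {1..n}"]) auto
  have "(\<Sum>a\<in>{1..n}. \<Sum>b\<in>{1..n}. f a b) = (\<Sum>(a, b)\<in>{1..n} \<times> {1..n}. f a b)"
    by (rule sum.cartesian_product)
  also have "\<dots> = (\<Sum>(a, b)\<in>pairs n. f a b) + (\<Sum>(a, b)\<in>?Q. f a b) + (\<Sum>(a, b)\<in>?D. f a b)"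
  proof -
    have "pairs n \<inter> ?Q = {}" "(pairs n \<union> ?Q) \<inter> ?D = {}" by (auto simp: pairs_def)
    thus ?thesis unfolding split using fin by (simp add: sum.union_disjoint)
  qed
  also have "(\<Sum>(a, b)\<in>?D. f a b) = 0" using diag by (intro sum.neutral) auto
  also have "(\<Sum>(a, b)\<in>?Q. f a b) = (\<Sum>(a, b)\<in>pairs n. f a b)"
    using sym by (intro sum.reindex_bij_witness[where i = prod.swap and j = prod.swap]) (auto simp: pairs_def)
  finally show ?thesis by simp
qed

text \<open>Multiplying by the unit number cnj (y a) * x b turns the difference of the two matrices
  into a difference of the ratios x * cnj y at the vertices. The energy thus depends on these ratios
  alone.\<close>

lemma norm_P_diff:
  assumes "cmod (x a) = 1" "cmod (x b) = 1" "cmod (y a) = 1" "cmod (y b) = 1"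
  shows "cmod (P_diff x y (a, b)) = cmod (x a * cnj (y a) - x b * cnj (y b))"
proof -
  have "cmod (P_diff x y (a, b)) = cmod (P_diff x y (a, b) * (cnj (y a) * x b))"
    using assms by (simp add: norm_mult)
  also have "P_diff x y (a, b) * (cnj (y a) * x b) = x a * cnj (y a) * (x b * cnj (x b)) - (y a * cnj (y a)) * (x b * cnj (y b))"
    by (simp add: P_diff_def P_mat_def algebra_simps)
  also have "\<dots> = x a * cnj (y a) - x b * cnj (y b)"
    using assms by (simp only: unit_cnj_mult) simp
  finally show ?thesis .
qed

lemma energy_eq:
  assumes x: "\<And>a. a \<in> {1..n} \<Longrightarrow> cmod (x a) = 1" and y: "\<And>a. a \<in> {1..n} \<Longrightarrow> cmod (y a) = 1"
  shows "2 * energy n x y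
    = (\<Sum>a\<in>{1..n}. \<Sum>b\<in>{1..n}. (cmod (x a * cnj (y a) - x b * cnj (y b)))\<^sup>2)"
proof -
  have "energy n x y = (\<Sum>(a, b)\<in>pairs n. (cmod (x a * cnj (y a) - x b * cnj (y b)))\<^sup>2)"
    unfolding energy_def using x y
    by (intro sum.cong) (auto simp: pairs_def norm_P_diff)
  thus ?thesis by (subst sum_symmetric) (auto simp: norm_minus_commute)
qed

lemma objective_diff:
  assumes x: "\<And>a. a \<in> {1..n} \<Longrightarrow> cmod (x a) = 1" and y: "\<And>a. a \<in> {1..n} \<Longrightarrow> cmod (y a) = 1"
    and w: "\<And>a b. a \<in> {1..n} \<Longrightarrow> b \<in> {1..n} \<Longrightarrow> w b a = cnj (w a b)"
  shows "objective n (observation y \<sigma> w) x - objective n (observation y \<sigma> w) y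
    = 2 * energy n x y - 4 * \<sigma> * (\<Sum>p\<in>pairs n. Re (cnj (P_diff x y p) * (case p of (a, b) \<Rightarrow> w a b)))"
proof -
  let ?A = "\<lambda>a b. P_diff x y (a, b)"
  have obj: "objective n U v = (\<Sum>a\<in>{1..n}. \<Sum>b\<in>{1..n}. (cmod (U a b - P_mat v a b))\<^sup>2)" for U v
    unfolding objective_def frobenius_norm_def by (simp add: sum_nonneg)
  \<comment> \<open>Writing A for P(x) - P(y), the residual at \<open>x\<close> is \<sigma> w - A
    and the one at \<open>y\<close> is \<sigma> w, so the pure noise term cancels.\<close>
  have sq: "(cmod (observation y \<sigma> w a b - P_mat x a b))\<^sup>2 - (cmod (observation y \<sigma> w a b - P_mat y a b))\<^sup>2
     = (cmod (?A a b))\<^sup>2 - 2 * \<sigma> * Re (cnj (?A a b) * w a b)" for a b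
    unfolding observation_def P_diff_def prod.case cmod_power2
    by (simp add: power2_eq_square algebra_simps)
  have herm: "?A b a = cnj (?A a b)" for a b by (simp add: P_diff_def P_mat_def mult.commute)
  have diag: "?A a a = 0" if "a \<in> {1..n}" for a
    using x[OF that] y[OF that] by (simp add: P_diff_def P_mat_def unit_cnj_mult)
  have "objective n (observation y \<sigma> w) x - objective n (observation y \<sigma> w) y
     = (\<Sum>a\<in>{1..n}. \<Sum>b\<in>{1..n}. (cmod (?A a b))\<^sup>2 - 2 * \<sigma> * Re (cnj (?A a b) * w a b))"
    by (simp add: obj sq flip: sum_subtractf)
  also have "\<dots> = 2 * (\<Sum>(a, b)\<in>pairs n. (cmod (?A a b))\<^sup>2 - 2 * \<sigma> * Re (cnj (?A a b) * w a b))"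
  proof (rule sum_symmetric)
    fix a b assume ab: "a \<in> {1..n}" "b \<in> {1..n}"
    show "(cmod (?A a b))\<^sup>2 - 2 * \<sigma> * Re (cnj (?A a b) * w a b)
        = (cmod (?A b a))\<^sup>2 - 2 * \<sigma> * Re (cnj (?A b a) * w b a)"
      by (simp add: w[OF ab] herm[of b a])
  qed (simp add: diag)
  also have "\<dots> = 2 * energy n x y - 4 * \<sigma> * (\<Sum>p\<in>pairs n. Re (cnj (P_diff x y p) * (case p of (a, b) \<Rightarrow> w a b)))"
    by (simp add: energy_def case_prod_unfold sum_subtractf right_diff_distrib mult.assoc flip: sum_distrib_left)
  finally show ?thesis .
qed

lemma Theta_unit: "k > 0 \<Longrightarrow> x \<in> Theta n k \<Longrightarrow> a \<in> {1..n} \<Longrightarrow> cmod (x a) = 1"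
  using colors_eq_roots_unity[of k] root_unity_norm[of k "x a"] by (auto simp: Theta_def PiE_def Pi_def)

lemma Theta_root: "k > 0 \<Longrightarrow> x \<in> Theta n k \<Longrightarrow> a \<in> {1..n} \<Longrightarrow> x a ^ k = 1"
  using colors_eq_roots_unity[of k] by (auto simp: Theta_def PiE_def Pi_def)

lemma finite_Theta: "k > 0 \<Longrightarrow> finite (Theta n k)"
  unfolding Theta_def by (intro finite_PiE) (auto simp: colors_def)

lemma card_colors: "k > 0 \<Longrightarrow> card (colors k) = k"
  by (simp add: colors_eq_roots_unity card_roots_unity_eq)

section \<open>Mismatches, alignment and lower bounds on the energy\<close>

definition mismatches :: "nat \<Rightarrow> (nat \<Rightarrow> complex) \<Rightarrow> (nat \<Rightarrow> complex) \<Rightarrow> nat" where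
  "mismatches n x y = card {a\<in>{1..n}. x a \<noteq> y a}"

text \<open>Every class of \<^const>\<open>color_equiv\<close> has a representative in which the commonest ratio
  between the two assignments is \<open>1\<close>.\<close>

definition aligned :: "nat \<Rightarrow> (nat \<Rightarrow> complex) \<Rightarrow> (nat \<Rightarrow> complex) \<Rightarrow> bool" where
  "aligned n x y \<longleftrightarrow> (\<forall>\<zeta>. card {a\<in>{1..n}. x a * cnj (y a) = \<zeta>} \<le> card {a\<in>{1..n}. x a = y a})"

context
  fixes n k :: nat and x y :: "nat \<Rightarrow> complex"
  assumes k: "k > 0" and x: "x \<in> Theta n k" and y: "y \<in> Theta n k"
begin

lemma ratio_eq_one_iff:
  assumes "a \<in> {1..n}"
  shows "x a * cnj (y a) = 1 \<longleftrightarrow> x a = y a"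
proof
  assume "x a * cnj (y a) = 1"
  hence "x a * (y a * cnj (y a)) = y a" by (simp add: algebra_simps)
  thus "x a = y a" using Theta_unit[OF k y assms] by (simp add: unit_cnj_mult)
qed (use Theta_unit[OF k y assms] in \<open>simp add: unit_cnj_mult\<close>)

lemma ratio_root:
  assumes "a \<in> {1..n}"
  shows "(x a * cnj (y a)) ^ k = 1"
  using Theta_root[OF k x assms] Theta_root[OF k y assms]
  by (simp add: power_mult_distrib flip: complex_cnj_power)

text \<open>The ratios are \<open>k\<close>th roots of unity, so each ordered pair of vertices with
  different ratios adds at least 2 (1 - cos (2 pi / k)) to twice the energy.\<close>

lemma energy_ge_disagreements:
  "(1 - cos (2 * pi / real k)) * (\<Sum>a\<in>{1..n}. real (card {b\<in>{1..n}. x b * cnj (y b) \<noteq> x a * cnj (y a)}))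
    \<le> energy n x y"
proof -
  define z where "z = (\<lambda>a. x a * cnj (y a))"
  define c where "c = 1 - cos (2 * pi / real k)"
  have "2 * c * (\<Sum>a\<in>{1..n}. real (card {b\<in>{1..n}. z b \<noteq> z a}))
     = (\<Sum>a\<in>{1..n}. \<Sum>b\<in>{1..n}. if z b \<noteq> z a then 2 * c else 0)"
    by (simp add: sum_distrib_left mult.commute flip: sum.inter_filter)
  also have "\<dots> \<le> (\<Sum>a\<in>{1..n}. \<Sum>b\<in>{1..n}. (cmod (z a - z b))\<^sup>2)"
    using roots_unity_dist[OF k ratio_root ratio_root] by (intro sum_mono) (auto simp: z_def c_def)
  also have "\<dots> = 2 * energy n x y"
    unfolding z_def using Theta_unit[OF k x] Theta_unit[OF k y] by (subst energy_eq) auto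
  finally show ?thesis by (simp only: z_def c_def mult.assoc)
qed

lemma card_agreements: "real (card {a\<in>{1..n}. x a = y a}) = real n - real (mismatches n x y)"
proof -
  have "{a\<in>{1..n}. x a = y a} \<union> {a\<in>{1..n}. x a \<noteq> y a} = {1..n}" by auto
  hence "card {a\<in>{1..n}. x a = y a} + mismatches n x y = n"
    unfolding mismatches_def by (subst card_Un_disjoint[symmetric]) auto
  thus ?thesis by linarith
qed

text \<open>Agreeing vertices have ratio 1 and mismatched ones do not. With m mismatches, each of
  the n - m agreeing vertices differs in ratio from m others, and each mismatched vertex from at
  least n - m, which makes 2 m (n - m) ordered pairs.\<close>

lemma energy_ge_small:
  "2 * (1 - cos (2 * pi / real k)) * real (mismatches n x y) * (real n - real (mismatches n x y))
    \<le> energy n x y"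
proof -
  define z where "z = (\<lambda>a. x a * cnj (y a))"
  define m where "m = real (mismatches n x y)"
  let ?A = "{a\<in>{1..n}. x a = y a}" and ?B = "{a\<in>{1..n}. x a \<noteq> y a}"
  let ?f = "\<lambda>a. real (card {b\<in>{1..n}. z b \<noteq> z a})"
  have one: "\<forall>b\<in>{1..n}. z b = 1 \<longleftrightarrow> x b = y b" using ratio_eq_one_iff by (simp add: z_def)
  have A: "m \<le> ?f a" if "a \<in> ?A" for a
  proof -
    have "z a = 1" using that one by blast
    hence "?B \<subseteq> {b\<in>{1..n}. z b \<noteq> z a}" using one by (simp add: subset_iff)
    thus ?thesis unfolding m_def mismatches_def by (intro of_nat_mono card_mono) auto
  qed
  have B: "real n - m \<le> ?f a" if "a \<in> ?B" for a
  proof -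
    have "z a \<noteq> 1" using that one by blast
    moreover have "\<forall>b\<in>?A. z b = 1" using one by blast
    ultimately have "?A \<subseteq> {b\<in>{1..n}. z b \<noteq> z a}" by auto
    thus ?thesis unfolding m_def card_agreements[symmetric] by (intro of_nat_mono card_mono) auto
  qed
  have "2 * m * (real n - m) = (\<Sum>a\<in>?A. m) + (\<Sum>a\<in>?B. real n - m)"
    using card_agreements by (simp add: m_def mismatches_def)
  also have "\<dots> \<le> (\<Sum>a\<in>?A. ?f a) + (\<Sum>a\<in>?B. ?f a)"
    using A B by (intro add_mono sum_mono) auto
  also have "\<dots> = (\<Sum>a\<in>?A \<union> ?B. ?f a)" by (intro sum.union_disjoint[symmetric]) auto
  also have "?A \<union> ?B = {1..n}" by auto
  finally have "(1 - cos (2 * pi / real k)) * (2 * m * (real n - m))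
      \<le> (1 - cos (2 * pi / real k)) * (\<Sum>a\<in>{1..n}. ?f a)"
    by (intro mult_left_mono) auto
  also have "\<dots> \<le> energy n x y" using energy_ge_disagreements by (simp add: z_def)
  finally show ?thesis by (simp only: m_def mult_ac)
qed

text \<open>By alignment no ratio is shared by more than the n - m agreeing vertices, so every
  vertex differs in ratio from at least m others. This bound stays linear in m where m (n - m)
  degenerates.\<close>

lemma energy_ge_aligned:
  assumes "aligned n x y"
  shows "(1 - cos (2 * pi / real k)) * real n * real (mismatches n x y) \<le> energy n x y"
proof -
  define z where "z = (\<lambda>a. x a * cnj (y a))"
  define m where "m = real (mismatches n x y)"
  have "m \<le> real (card {b\<in>{1..n}. z b \<noteq> z a})" for a
  proof -
    have "{b\<in>{1..n}. z b = z a} \<union> {b\<in>{1..n}. z b \<noteq> z a} = {1..n}" by auto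
    hence "card {b\<in>{1..n}. z b = z a} + card {b\<in>{1..n}. z b \<noteq> z a} = n"
      by (subst card_Un_disjoint[symmetric]) auto
    moreover have "card {b\<in>{1..n}. z b = z a} \<le> card {a\<in>{1..n}. x a = y a}"
      using assms by (auto simp: aligned_def z_def)
    ultimately show ?thesis using card_agreements unfolding m_def by linarith
  qed
  hence "(\<Sum>a\<in>{1..n}. m) \<le> (\<Sum>a\<in>{1..n}. real (card {b\<in>{1..n}. z b \<noteq> z a}))"
    by (intro sum_mono)
  hence "(1 - cos (2 * pi / real k)) * (real n * m)
      \<le> (1 - cos (2 * pi / real k)) * (\<Sum>a\<in>{1..n}. real (card {b\<in>{1..n}. z b \<noteq> z a}))"
    by (intro mult_left_mono) auto
  thus ?thesis using energy_ge_disagreements by (simp add: z_def m_def mult_ac)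
qed

end

text \<open>The sum factorizes over the vertices: at each of them the color of \<open>y\<close> has
  weight 1 and the other k - 1 colors have weight \<open>g\<close>.\<close>

lemma sum_power_mismatches:
  fixes g :: real
  assumes k: "k > 0" and y: "y \<in> Theta n k"
  shows "(\<Sum>x\<in>Theta n k. g ^ mismatches n x y) = (1 + (real k - 1) * g) ^ n"
proof -
  have fin: "finite (colors k)" by (simp add: colors_def)
  have "g ^ mismatches n x y = (\<Prod>a\<in>{1..n}. if x a \<noteq> y a then g else 1)" for x
    unfolding mismatches_def by (simp flip: prod.inter_filter)
  hence "(\<Sum>x\<in>Theta n k. g ^ mismatches n x y)
      = (\<Prod>a\<in>{1..n}. \<Sum>v\<in>colors k. if v \<noteq> y a then g else 1)"
    unfolding Theta_def using fin by (subst prod_sum_PiE) auto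
  also have "\<dots> = (\<Prod>a\<in>{1..n}. 1 + (real k - 1) * g)"
  proof (rule prod.cong)
    fix a assume "a \<in> {1..n}"
    hence ya: "y a \<in> colors k" using y by (auto simp: Theta_def)
    have "(\<Sum>v\<in>colors k. if v \<noteq> y a then g else 1) = 1 + (\<Sum>v\<in>colors k - {y a}. g)"
      using fin ya by (subst sum.remove[of _ "y a"]) auto
    also have "\<dots> = 1 + (real k - 1) * g"
      using fin ya k card_colors[OF k] by (simp add: of_nat_diff)
    finally show "(\<Sum>v\<in>colors k. if v \<noteq> y a then g else 1) = 1 + (real k - 1) * g" .
  qed simp
  finally show ?thesis by simp
qed

section \<open>Union bound over competitors\<close>

lemma Theta_A_subset: "x \<in> Theta_A n k \<Longrightarrow> x \<in> Theta n k"
  by (simp add: Theta_A_def)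

lemma standard_GUE_family:
  assumes "prob_space M" "standard_GUE M n W"
  shows "complex_gaussian_family M (pairs n) (\<lambda>p \<omega>. case p of (a, b) \<Rightarrow> W \<omega> a b)"
proof -
  interpret prob_space M by fact
  have "indep_vars (\<lambda>_. borel) (\<lambda>(a, b) \<omega>. W \<omega> a b) {(a, b). a \<in> {1..n} \<and> b \<in> {1..n} \<and> a \<le> b}"
    using assms(2) by (simp add: standard_GUE_def)
  hence "indep_vars (\<lambda>_. borel) (\<lambda>(a, b) \<omega>. W \<omega> a b) (pairs n)"
    by (rule indep_vars_subset) (auto simp: pairs_def)
  moreover have "(\<lambda>(a, b) \<omega>. W \<omega> a b) = (\<lambda>p \<omega>. case p of (a, b) \<Rightarrow> W \<omega> a b)"
    by (auto simp: fun_eq_iff)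
  moreover have "std_complex_gaussian M (\<lambda>\<omega>. case p of (a, b) \<Rightarrow> W \<omega> a b)" if "p \<in> pairs n" for p
    using assms(2) that unfolding standard_GUE_def by (force simp: pairs_def)
  ultimately show ?thesis by unfold_locales auto
qed

lemma objective_cong:
  assumes "\<And>a b. a \<in> {1..n} \<Longrightarrow> b \<in> {1..n} \<Longrightarrow> P_mat x a b = P_mat x' a b"
  shows "objective n U x = objective n U x'"
  unfolding objective_def frobenius_norm_def using assms by simp

lemma P_mat_rotate:
  assumes "cmod \<zeta> = 1"
  shows "P_mat (\<lambda>a. \<zeta> * x a) a b = P_mat x a b"
proof -
  have "P_mat (\<lambda>a. \<zeta> * x a) a b = (\<zeta> * cnj \<zeta>) * P_mat x a b"
    by (simp add: P_mat_def mult_ac)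
  thus ?thesis using assms by (simp add: unit_cnj_mult)
qed

text \<open>Multiplying \<open>x\<close> by the conjugate of its commonest ratio to \<open>y\<close>
  moves that ratio to 1. The factor is a \<open>k\<close>th root of unity, so the colors are
  preserved, and it cancels in P(x).\<close>

lemma exists_aligned_representative:
  assumes k: "k > 0" and n: "n > 0" and x: "x \<in> Theta n k" and y: "y \<in> Theta n k"
  obtains x' where "x' \<in> Theta n k" "aligned n x' y" "\<And>U. objective n U x' = objective n U x"
    "x' = y \<Longrightarrow> color_equiv n x y"
proof -
  let ?N = "\<lambda>\<zeta>. card {a\<in>{1..n}. x a * cnj (y a) = \<zeta>}"
  let ?Z = "(\<lambda>a. x a * cnj (y a)) ` {1..n}"
  have "finite (?N ` ?Z)" "?N ` ?Z \<noteq> {}" using n by auto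
  from Max_in[OF this] obtain \<zeta> where z: "Max (?N ` ?Z) = ?N \<zeta>" "\<zeta> \<in> ?Z"
    by (rule imageE)
  have max: "?N \<xi> \<le> ?N \<zeta>" for \<xi>
  proof (cases "\<xi> \<in> ?Z")
    case True
    hence "?N \<xi> \<in> ?N ` ?Z" by blast
    thus ?thesis unfolding z(1)[symmetric] by (intro Max_ge finite_imageI) auto
  next
    case False
    hence "{a\<in>{1..n}. x a * cnj (y a) = \<xi>} = {}" by blast
    thus ?thesis by (simp only: card.empty)
  qed
  obtain a0 where a0: "a0 \<in> {1..n}" "\<zeta> = x a0 * cnj (y a0)" using z(2) by auto
  have root: "\<zeta> ^ k = 1" using ratio_root[OF k x y a0(1)] a0(2) by simp
  have unit: "cmod \<zeta> = 1" by (rule root_unity_norm[OF k root])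
  hence mul: "\<zeta> * cnj \<zeta> = 1" by (rule unit_cnj_mult)
  define x' where "x' = (\<lambda>a\<in>{1..n}. cnj \<zeta> * x a)"
  have x': "x' \<in> Theta n k"
  proof -
    have "(cnj \<zeta> * x a) ^ k = 1" if "a \<in> {1..n}" for a
      using root Theta_root[OF k x that] by (simp add: power_mult_distrib flip: complex_cnj_power)
    thus ?thesis unfolding Theta_def x'_def colors_eq_roots_unity[OF k] by auto
  qed
  have ratio: "x' a * cnj (y a) = \<xi> \<longleftrightarrow> x a * cnj (y a) = \<zeta> * \<xi>" if "a \<in> {1..n}" for a \<xi>
  proof -
    have "\<zeta> * (x' a * cnj (y a)) = (\<zeta> * cnj \<zeta>) * (x a * cnj (y a))" using that by (simp add: x'_def)
    also have "\<dots> = x a * cnj (y a)" by (simp add: mul)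
    finally have "\<zeta> * (x' a * cnj (y a)) = x a * cnj (y a)" .
    moreover have "x' a * cnj (y a) = \<xi> \<longleftrightarrow> \<zeta> * (x' a * cnj (y a)) = \<zeta> * \<xi>" using unit by auto
    ultimately show ?thesis by (simp only:)
  qed
  have "card {a\<in>{1..n}. x' a = y a} = ?N \<zeta>"
  proof -
    have "{a\<in>{1..n}. x' a = y a} = {a\<in>{1..n}. x a * cnj (y a) = \<zeta>}"
      using ratio[of _ 1] ratio_eq_one_iff[OF k x' y] by (intro Collect_cong) auto
    thus ?thesis by simp
  qed
  moreover have "{a\<in>{1..n}. x' a * cnj (y a) = \<xi>} = {a\<in>{1..n}. x a * cnj (y a) = \<zeta> * \<xi>}" for \<xi>
    using ratio by (intro Collect_cong) auto
  ultimately have "aligned n x' y" using max by (simp add: aligned_def)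
  moreover have "objective n U x' = objective n U x" for U
  proof (rule objective_cong)
    fix a b assume "a \<in> {1..n}" "b \<in> {1..n}"
    hence "P_mat x' a b = P_mat (\<lambda>a. cnj \<zeta> * x a) a b" by (simp add: x'_def P_mat_def)
    thus "P_mat x' a b = P_mat x a b" using unit by (simp only: P_mat_rotate complex_mod_cnj)
  qed
  moreover have "color_equiv n x y" if "x' = y"
    unfolding color_equiv_def
  proof (intro exI ballI)
    fix a assume "a \<in> {1..n}"
    \<comment> \<open>Equivalence asks for a real angle, and the argument of the unit factor
      provides it.\<close>
    moreover have "cis (Arg (cnj \<zeta>)) = cnj \<zeta>" using unit by (subst cis_Arg) (auto simp: sgn_eq)
    ultimately show "cis (Arg (cnj \<zeta>)) * x a = y a" using that by (auto simp: x'_def)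
  qed
  ultimately show ?thesis using that x' by blast
qed

text \<open>If the estimate is outside the class of \<open>y\<close>, its aligned representative
  differs from \<open>y\<close> and has an objective no larger than that of \<open>y\<close>. Each
  such event has a Chernoff bound, and these are summed over all aligned competitors.\<close>

lemma misclassification_bound:
  assumes M: "prob_space M" and W: "standard_GUE M n W" and k: "k > 0" and n: "n > 0"
    and y: "y \<in> Theta_A n k" and arg: "argmin_estimator M n k (\<lambda>\<omega>. observation y \<sigma> (W \<omega>)) yA"
    and s: "0 < s" "\<sigma>\<^sup>2 \<le> s"
  shows "1 - (\<Sum>x\<in>{x \<in> Theta n k. x \<noteq> y \<and> aligned n x y}. exp (- energy n x y / (4 * s)))
    \<le> \<P>(\<omega> in M. yA \<omega> \<in> theta_class n k y)"
proof -
  interpret complex_gaussian_family M "pairs n" "\<lambda>p \<omega>. case p of (a, b) \<Rightarrow> W \<omega> a b"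
    by (rule standard_GUE_family[OF M W])
  let ?X = "{x \<in> Theta n k. x \<noteq> y \<and> aligned n x y}"
  have yT: "y \<in> Theta n k" using y by (rule Theta_A_subset)
  have finX: "finite ?X" using finite_Theta[OF k] by simp
  \<comment> \<open>The factor 2 \<sigma> is kept inside the coefficients, so no division by
    \<sigma> occurs and its sign is immaterial.\<close>
  define E where "E = (\<lambda>x. {\<omega>\<in>space M. energy n x y \<le> lin (\<lambda>p. of_real (2 * \<sigma>) * P_diff x y p) (pairs n) \<omega>})"
  have measE: "E x \<in> events" for x
    unfolding E_def using lin_measurable[OF order_refl] by measurable
  have probE: "prob (E x) \<le> exp (- energy n x y / (4 * s))" for x
  proof -
    have q: "0 \<le> energy n x y" by (simp add: energy_def sum_nonneg)
    \<comment> \<open>The Chernoff parameter 1 / (2 s) is optimal at \<sigma>^2 = s; for smaller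
      \<sigma>^2 the exponent only decreases.\<close>
    have "prob (E x) \<le> exp ((1 / (2 * s))\<^sup>2 * (\<Sum>p\<in>pairs n. (cmod (of_real (2 * \<sigma>) * P_diff x y p))\<^sup>2) / 4
        - 1 / (2 * s) * energy n x y)"
      unfolding E_def using s by (intro lin_upper_tail) auto
    also have "(\<Sum>p\<in>pairs n. (cmod (of_real (2 * \<sigma>) * P_diff x y p))\<^sup>2) = 4 * \<sigma>\<^sup>2 * energy n x y"
      by (simp add: energy_def norm_mult power_mult_distrib sum_distrib_left)
    also have "(1 / (2 * s))\<^sup>2 * (4 * \<sigma>\<^sup>2 * energy n x y) / 4 - 1 / (2 * s) * energy n x y
        = energy n x y / (4 * s\<^sup>2) * \<sigma>\<^sup>2 - 1 / (2 * s) * energy n x y"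
      using s by (simp add: field_simps)
    also have "\<dots> \<le> energy n x y / (4 * s\<^sup>2) * s - 1 / (2 * s) * energy n x y"
      using q s by (intro diff_right_mono mult_left_mono) auto
    also have "\<dots> = - energy n x y / (4 * s)"
      using s by (simp add: field_simps power2_eq_square)
    finally show ?thesis by simp
  qed
  have good: "{\<omega> \<in> space M. yA \<omega> \<in> theta_class n k y} \<in> events"
  proof -
    have [measurable]: "yA \<in> measurable M (count_space (Theta_A n k))"
      using arg by (simp add: argmin_estimator_def)
    have "yA -` (theta_class n k y) \<inter> space M \<in> events"
      by (rule measurable_sets[of yA M "count_space (Theta_A n k)"]) (auto simp: theta_class_def)
    moreover have "yA -` (theta_class n k y) \<inter> space M = {\<omega> \<in> space M. yA \<omega> \<in> theta_class n k y}" by auto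
    ultimately show ?thesis by simp
  qed
  have sub: "{\<omega> \<in> space M. yA \<omega> \<notin> theta_class n k y} \<subseteq> (\<Union>x\<in>?X. E x)"
  proof
    fix \<omega> assume w: "\<omega> \<in> {\<omega> \<in> space M. yA \<omega> \<notin> theta_class n k y}"
    hence "is_arg_min (objective n (observation y \<sigma> (W \<omega>))) (\<lambda>x. x \<in> Theta_A n k) (yA \<omega>)"
      using arg by (auto simp: argmin_estimator_def)
    hence yA: "yA \<omega> \<in> Theta_A n k"
      "objective n (observation y \<sigma> (W \<omega>)) (yA \<omega>) \<le> objective n (observation y \<sigma> (W \<omega>)) y"
      using y by (auto simp: is_arg_min_linorder)
    obtain x' where x': "x' \<in> Theta n k" "aligned n x' y" "\<And>U. objective n U x' = objective n U (yA \<omega>)"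
      "x' = y \<Longrightarrow> color_equiv n (yA \<omega>) y"
      by (rule exists_aligned_representative[OF k n Theta_A_subset[OF yA(1)] yT]) (rule that)
    have "x' \<noteq> y" using x'(4) w yA(1) by (auto simp: theta_class_def)
    moreover have "\<omega> \<in> E x'"
    proof -
      have herm: "W \<omega> b a = cnj (W \<omega> a b)" if "a \<in> {1..n}" "b \<in> {1..n}" for a b
        using W w that unfolding standard_GUE_def by blast
      have "objective n (observation y \<sigma> (W \<omega>)) x' - objective n (observation y \<sigma> (W \<omega>)) y
          = 2 * energy n x' y - 4 * \<sigma> * lin (P_diff x' y) (pairs n) \<omega>"
        unfolding lin_def by (intro objective_diff Theta_unit[OF k x'(1)] Theta_unit[OF k yT] herm)
      hence "2 * energy n x' y - 4 * \<sigma> * lin (P_diff x' y) (pairs n) \<omega> \<le> 0"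
        using yA(2) x'(3) by simp
      thus ?thesis using w by (simp add: E_def lin_scaleR del: of_real_mult)
    qed
    ultimately show "\<omega> \<in> (\<Union>x\<in>?X. E x)" using x' by blast
  qed
  have "1 - \<P>(\<omega> in M. yA \<omega> \<in> theta_class n k y) = \<P>(\<omega> in M. yA \<omega> \<notin> theta_class n k y)"
    using prob_neg[OF good] by simp
  also have "\<dots> \<le> prob (\<Union>x\<in>?X. E x)"
    using sub measE finX by (intro finite_measure_mono) auto
  also have "\<dots> \<le> (\<Sum>x\<in>?X. prob (E x))"
    using measE finX by (intro finite_measure_subadditive_finite) auto
  also have "\<dots> \<le> (\<Sum>x\<in>?X. exp (- energy n x y / (4 * s)))"
    by (intro sum_mono probE)
  finally show ?thesis by simp
qed

section \<open>Swapping two colors\<close>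

definition swap_colors :: "(nat \<Rightarrow> complex) \<Rightarrow> nat \<Rightarrow> nat \<Rightarrow> nat \<Rightarrow> complex" where
  "swap_colors y a b = y(a := y b, b := y a)"

text \<open>A swap is composition with a transposition of vertices, so all color classes keep their
  sizes.\<close>

lemma swap_colors_in_Theta_A:
  assumes y: "y \<in> Theta_A n k" and a: "a \<in> {1..n}" and b: "b \<in> {1..n}"
  shows "swap_colors y a b \<in> Theta_A n k"
proof -
  have "swap_colors y a b \<in> Theta n k"
    using y a b by (auto simp: swap_colors_def Theta_A_def Theta_def PiE_iff extensional_def)
  moreover have "card {c\<in>{1..n}. swap_colors y a b c = v} = card {c\<in>{1..n}. y c = v}" for v
  proof (rule bij_betw_same_card)
    have eq: "swap_colors y a b c = y (Transposition.transpose a b c)" for c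
      by (auto simp: swap_colors_def Transposition.transpose_def)
    show "bij_betw (Transposition.transpose a b) {c\<in>{1..n}. swap_colors y a b c = v} {c\<in>{1..n}. y c = v}"
      using a b by (intro bij_betwI[where g = "Transposition.transpose a b"]) (auto simp: eq Transposition.transpose_def)
  qed
  ultimately show ?thesis using y by (simp add: Theta_A_def)
qed

text \<open>Expanding the squares gives 2 |A| times the sum of the squared moduli, minus twice the
  squared modulus of the sum of the \<open>e i\<close>; the latter is dropped.\<close>

lemma sum_dist_squares_le:
  fixes e :: "'i \<Rightarrow> complex"
  shows "(\<Sum>i\<in>A. \<Sum>j\<in>A. (cmod (e i - e j))\<^sup>2) \<le> 2 * real (card A) * (\<Sum>i\<in>A. (cmod (e i))\<^sup>2)"
proof -
  have sq: "(cmod (e i - e j))\<^sup>2 = (cmod (e i))\<^sup>2 + (cmod (e j))\<^sup>2 - 2 * Re (e i * cnj (e j))" for i j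
    unfolding cmod_power2 by (simp add: power2_eq_square algebra_simps)
  have "(\<Sum>i\<in>A. \<Sum>j\<in>A. Re (e i * cnj (e j))) = Re ((\<Sum>i\<in>A. e i) * cnj (\<Sum>i\<in>A. e i))"
    by (simp only: cnj_sum sum_product Re_sum)
  also have "\<dots> = (cmod (\<Sum>i\<in>A. e i))\<^sup>2" by (simp only: complex_norm_square[symmetric] Re_complex_of_real)
  finally have "(\<Sum>i\<in>A. \<Sum>j\<in>A. Re (e i * cnj (e j))) \<ge> 0" by simp
  moreover have "(\<Sum>i\<in>A. \<Sum>j\<in>A. (cmod (e i - e j))\<^sup>2)
      = 2 * real (card A) * (\<Sum>i\<in>A. (cmod (e i))\<^sup>2) - 2 * (\<Sum>i\<in>A. \<Sum>j\<in>A. Re (e i * cnj (e j)))"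
    by (simp only: sq sum_subtractf sum.distrib sum_constant flip: sum_distrib_left)
  ultimately show ?thesis by simp
qed

lemma energy_swap_le:
  assumes y: "\<And>c. c \<in> {1..n} \<Longrightarrow> cmod (y c) = 1" and a: "a \<in> {1..n}" and b: "b \<in> {1..n}"
  shows "energy n (swap_colors y a b) y \<le> 2 * real n * (cmod (y a - y b))\<^sup>2"
proof -
  define x where "x = swap_colors y a b"
  \<comment> \<open>Subtracting 1 from the ratios leaves their differences unchanged and makes them
    vanish off the two swapped vertices.\<close>
  define e where "e = (\<lambda>c. x c * cnj (y c) - 1)"
  have x: "cmod (x c) = 1" if "c \<in> {1..n}" for c
    using y a b that by (simp add: x_def swap_colors_def)
  have e: "cmod (e c) = cmod (x c - y c)" if "c \<in> {1..n}" for c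
  proof -
    have "e c = (x c - y c) * cnj (y c)"
      using y[OF that] by (simp add: e_def unit_cnj_mult left_diff_distrib)
    thus ?thesis using y[OF that] by (simp add: norm_mult)
  qed
  have "2 * energy n x y = (\<Sum>i\<in>{1..n}. \<Sum>j\<in>{1..n}. (cmod (e i - e j))\<^sup>2)"
    using energy_eq[of n x y] x y by (simp add: e_def)
  also have "\<dots> \<le> 2 * real n * (\<Sum>i\<in>{1..n}. (cmod (e i))\<^sup>2)"
    using sum_dist_squares_le[of e "{1..n}"] by simp
  also have "(\<Sum>i\<in>{1..n}. (cmod (e i))\<^sup>2) = (\<Sum>i\<in>{1..n}. (cmod (x i - y i))\<^sup>2)"
    using e by (intro sum.cong) auto
  also have "\<dots> = (\<Sum>i\<in>{a, b}. (cmod (x i - y i))\<^sup>2)"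
    using a b by (intro sum.mono_neutral_right) (auto simp: x_def swap_colors_def)
  also have "\<dots> \<le> 2 * (cmod (y a - y b))\<^sup>2"
    by (cases "a = b") (auto simp: x_def swap_colors_def norm_minus_commute)
  finally show ?thesis by (simp add: x_def mult_left_mono)
qed

text \<open>The pairs joining \<open>a\<close> to the complement of \<open>H\<close>: for distinct \<open>a \<in> H\<close> they are disjoint,
  which makes the corresponding Gaussian forms independent.\<close>

definition star_pairs :: "nat \<Rightarrow> nat set \<Rightarrow> nat \<Rightarrow> (nat \<times> nat) set" where
  "star_pairs n H a = {p \<in> pairs n. fst p = a \<and> snd p \<notin> H \<or> snd p = a \<and> fst p \<notin> H}"

lemma disjoint_star_pairs: "disjoint_family_on (star_pairs n H) H"
  by (auto simp: disjoint_family_on_def star_pairs_def)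

lemma card_star_pairs:
  assumes a: "a \<in> H" "a \<in> {1..n}" and H: "H \<subseteq> {1..n}"
  shows "real (card (star_pairs n H a)) = real n - real (card H)"
proof -
  have "c < a" if "c \<notin> H" "\<not> a < c" for c using a that by (cases c a rule: linorder_cases) auto
  hence "bij_betw (\<lambda>c. if a < c then (a, c) else (c, a)) ({1..n} - H) (star_pairs n H a)"
    using a by (intro bij_betwI[where g = "\<lambda>p. if fst p = a then snd p else fst p"])
      (auto simp: star_pairs_def pairs_def split: if_splits)
  hence "card (star_pairs n H a) = card ({1..n} - H)" by (simp add: bij_betw_same_card)
  also have "\<dots> = n - card H" using H by (subst card_Diff_subset) (auto intro: finite_subset)
  finally show ?thesis using card_mono[OF _ H] by (simp add: of_nat_diff)
qed

text \<open>In a star only the end \<open>a\<close> is recolored and the other end carries a unit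
  number. All coefficients have the same modulus, which makes the variance of a star form
  explicit.\<close>

lemma norm_P_diff_single:
  assumes y: "\<And>c. c \<in> {1..n} \<Longrightarrow> cmod (y c) = 1" and a: "a \<in> H" and p: "p \<in> star_pairs n H a"
  shows "cmod (P_diff (y(a := w)) y p) = cmod (w - y a)"
proof -
  obtain c d where cd: "p = (c, d)" "c \<in> {1..n}" "d \<in> {1..n}" "c \<noteq> d"
    using p by (cases p) (auto simp: star_pairs_def pairs_def)
  consider "c = a" "d \<noteq> a" | "d = a" "c \<noteq> a" using p a cd by (auto simp: star_pairs_def)
  thus ?thesis
  proof cases
    case 1
    hence "P_diff (y(a := w)) y p = (w - y a) * cnj (y d)"
      by (simp add: cd P_diff_def P_mat_def algebra_simps)
    thus ?thesis using y cd by (simp add: norm_mult)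
  next
    case 2
    hence "P_diff (y(a := w)) y p = y c * cnj (w - y a)"
      by (simp add: cd P_diff_def P_mat_def algebra_simps)
    thus ?thesis using y cd by (simp add: norm_mult del: complex_cnj_diff)
  qed
qed

text \<open>On the star of \<open>a\<close> the other end lies outside \<open>H\<close> and hence is
  not \<open>b\<close>, so the swap acts as a recoloring of \<open>a\<close> alone. The star form
  then sees \<open>b\<close> only through its color, which lets the maxima over the two classes be
  taken separately.\<close>

lemma P_diff_swap:
  assumes "a \<in> H" "b \<in> H"
  shows "p \<in> star_pairs n H a \<Longrightarrow> P_diff (swap_colors y a b) y p = P_diff (y(a := y b)) y p"
    and "p \<in> star_pairs n H b \<Longrightarrow> P_diff (swap_colors y a b) y p = P_diff (y(b := y a)) y p"
  using assms by (auto simp: star_pairs_def swap_colors_def P_diff_def P_mat_def pairs_def)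

lemma sum_rest_le:
  assumes y: "\<And>c. c \<in> {1..n} \<Longrightarrow> cmod (y c) = 1" and H: "H \<subseteq> {1..n}" and ab: "a \<in> H" "b \<in> H"
  shows "(\<Sum>p\<in>pairs n - star_pairs n H a - star_pairs n H b. (cmod (P_diff (swap_colors y a b) y p))\<^sup>2)
    \<le> 8 * real (card H)"
proof -
  let ?R = "pairs n - star_pairs n H a - star_pairs n H b"
  let ?A = "P_diff (swap_colors y a b) y"
  \<comment> \<open>A pair outside both stars has a nonzero coefficient only if one end is
    \<open>a\<close> or \<open>b\<close> and both ends lie in \<open>H\<close>. There are at most 2
    |H| such pairs, each with a coefficient of modulus at most 2.\<close>
  let ?T = "(\<lambda>(u, v). (min u v, max u v)) ` ({a, b} \<times> H)"
  have finH: "finite H" using H by (rule finite_subset) simp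
  have x: "cmod (swap_colors y a b c) = 1" if "c \<in> {1..n}" for c
    using y ab H that by (auto simp: swap_colors_def)
  have "?A p = 0" if p: "p \<in> ?R" "p \<notin> ?T" for p
  proof -
    obtain c d where cd: "p = (c, d)" "c < d" using p by (cases p) (auto simp: pairs_def)
    have "c \<notin> {a, b} \<or> d \<notin> H"
      using p(2) cd by (force simp: image_iff)
    moreover have "d \<notin> {a, b} \<or> c \<notin> H"
      using p(2) cd by (force simp: image_iff)
    ultimately have "c \<notin> {a, b} \<and> d \<notin> {a, b}"
      using p(1) cd ab by (auto simp: star_pairs_def)
    thus ?thesis by (simp add: cd P_diff_def P_mat_def swap_colors_def)
  qed
  hence "(\<Sum>p\<in>?R. (cmod (?A p))\<^sup>2) = (\<Sum>p\<in>?R \<inter> ?T. (cmod (?A p))\<^sup>2)"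
    by (intro sum.mono_neutral_right) auto
  also have "\<dots> \<le> (\<Sum>p\<in>?R \<inter> ?T. 4)"
  proof (rule sum_mono)
    fix p assume "p \<in> ?R \<inter> ?T"
    then obtain c d where cd: "p = (c, d)" "c \<in> {1..n}" "d \<in> {1..n}" by (cases p) (auto simp: pairs_def)
    have "cmod (?A p) \<le> cmod (P_mat (swap_colors y a b) c d) + cmod (P_mat y c d)"
      unfolding cd P_diff_def prod.case by (rule norm_triangle_ineq4)
    also have "\<dots> = 2" using x y cd by (simp add: P_mat_def norm_mult)
    finally show "(cmod (?A p))\<^sup>2 \<le> 4" using power_mono[of "cmod (?A p)" 2 2] by simp
  qed
  also have "\<dots> \<le> 4 * real (card ?T)"
    using finH by (simp add: card_mono)
  also have "card ?T \<le> card ({a, b} \<times> H)" using finH by (intro card_image_le) auto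
  also have "card ({a, b} \<times> H) \<le> 2 * card H"
    by (simp add: card_cartesian_product card_insert_if)
  finally show ?thesis by simp
qed

text \<open>The first term bounds the probability that one of the two maxima over the stars falls short of
  its level, the second one bounds the remainders, of variance \<open>O(N)\<close>, over all pairs.\<close>

lemma recovery_bound:
  fixes H\<^sub>1 H\<^sub>2 :: "nat set"
  assumes M: "prob_space M" and W: "standard_GUE M n W" and k: "k > 0"
    and y: "y \<in> Theta_A n k" and arg: "argmin_estimator M n k (\<lambda>\<omega>. observation y \<sigma> (W \<omega>)) yA"
    and H: "H\<^sub>1 \<subseteq> {a\<in>{1..n}. y a = u}" "H\<^sub>2 \<subseteq> {a\<in>{1..n}. y a = v}"
    and N: "card H\<^sub>1 = N" "card H\<^sub>2 = N" "0 < N" "2 * N < n"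
    and c: "0 < c" "(cmod (u - v))\<^sup>2 = 2 * c"
    and t: "0 \<le> t" and r: "0 \<le> r" and \<sigma>: "\<sigma> \<noteq> 0"
    and level: "4 * real n * c \<le> 2 * \<bar>\<sigma>\<bar> * (2 * t * sqrt (c * (real n - 2 * real N)) - r)"
  shows "\<P>(\<omega> in M. yA \<omega> \<in> theta_class n k y)
    \<le> 2 * (1 - exp (- (t + 1)\<^sup>2 / 2) / sqrt (2 * pi)) ^ N + (real N)\<^sup>2 * exp (- r\<^sup>2 / (16 * real N))"
proof -
  interpret complex_gaussian_family M "pairs n" "\<lambda>p \<omega>. case p of (a, b) \<Rightarrow> W \<omega> a b"
    by (rule standard_GUE_family[OF M W])
  define H where "H = H\<^sub>1 \<union> H\<^sub>2"
  have uv: "u \<noteq> v" using c by auto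
  have yT: "y \<in> Theta n k" using y by (rule Theta_A_subset)
  note unit = Theta_unit[OF k yT]
  have sub: "H \<subseteq> {1..n}" using H by (auto simp: H_def)
  have fin: "finite H\<^sub>1" "finite H\<^sub>2" using H by (auto intro: finite_subset)
  have cardH: "card H = 2 * N"
    unfolding H_def using fin H uv N by (subst card_Un_disjoint) auto
  have y1: "y a = u" "a \<in> {1..n}" "a \<in> H" if "a \<in> H\<^sub>1" for a using that H by (auto simp: H_def)
  have y2: "y b = v" "b \<in> {1..n}" "b \<in> H" if "b \<in> H\<^sub>2" for b using that H by (auto simp: H_def)
  \<comment> \<open>The sign of \<sigma> is absorbed into the coefficients, so large positive values
    of the forms always favour the swap.\<close>
  define s where "s = sgn \<sigma>"
  have s: "\<bar>s\<bar> = 1" "\<sigma> = s * \<bar>\<sigma>\<bar>" "s * \<bar>\<sigma>\<bar> = \<sigma>" using \<sigma> by (auto simp: s_def sgn_real_def)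
  \<comment> \<open>This is \<open>t\<close> standard deviations of a star form: its n - 2N
    coefficients have squared modulus 2c, so its variance is c (n - 2N).\<close>
  define g where "g = t * sqrt (c * (real n - 2 * real N))"
  define p where "p = exp (- (t + 1)\<^sup>2 / 2) / sqrt (2 * pi)"
  define A where "A = (\<lambda>w a q. of_real s * P_diff (y(a := w)) y q)"
  define B where "B = (\<lambda>a b q. of_real s * P_diff (swap_colors y a b) y q)"
  define J where "J = star_pairs n H"
  define R where "R = (\<lambda>a b. pairs n - J a - J b)"
  have J: "J a \<subseteq> pairs n" for a by (auto simp: J_def star_pairs_def)
  have R: "R a b \<subseteq> pairs n" for a b by (auto simp: R_def)
  note [measurable] = lin_measurable[OF J] lin_measurable[OF R]
  have star: "p \<le> \<P>(\<omega> in M. g \<le> lin (A w a) (J a) \<omega>)"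
    if a: "a \<in> H" and w: "(cmod (w - y a))\<^sup>2 = 2 * c" for w a
  proof -
    have "(\<Sum>q\<in>J a. (cmod (A w a q))\<^sup>2) = (\<Sum>q\<in>J a. 2 * c)"
      using norm_P_diff_single[OF unit a] s w unfolding J_def A_def
      by (intro sum.cong) (simp_all add: norm_mult)
    also have "\<dots> = 2 * (c * (real n - 2 * real N))"
      using card_star_pairs[OF a _ sub] a sub cardH by (auto simp: J_def)
    finally have S: "(\<Sum>q\<in>J a. (cmod (A w a q))\<^sup>2) = 2 * (c * (real n - 2 * real N))" .
    have pos: "0 < c * (real n - 2 * real N)" using c N by simp
    show ?thesis unfolding p_def
      using pos by (intro lin_lower_tail J t) (simp_all add: S g_def)
  qed
  define E1 where "E1 = {\<omega>\<in>space M. \<forall>a\<in>H\<^sub>1. lin (A v a) (J a) \<omega> < g}"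
  define E2 where "E2 = {\<omega>\<in>space M. \<forall>b\<in>H\<^sub>2. lin (A u b) (J b) \<omega> < g}"
  \<comment> \<open>The negated coefficients express a very negative remainder as an upper
    tail.\<close>
  define E3 where "E3 = (\<lambda>(a, b). {\<omega>\<in>space M. r \<le> lin (\<lambda>q. - B a b q) (R a b) \<omega>})"
  have disj: "disjoint_family_on J H\<^sub>1" "disjoint_family_on J H\<^sub>2"
    using disjoint_star_pairs[of n H] by (auto simp: J_def H_def disjoint_family_on_def)
  have P1: "prob E1 \<le> (1 - p) ^ N"
    using lin_all_below[OF fin(1) _ J disj(1), of p g "A v"] star y1 N c
    unfolding E1_def by (fastforce simp: norm_minus_commute)
  have P2: "prob E2 \<le> (1 - p) ^ N"
    using lin_all_below[OF fin(2) _ J disj(2), of p g "A u"] star y2 N c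
    unfolding E2_def by fastforce
  have P3: "prob (E3 ab) \<le> exp (- r\<^sup>2 / (16 * real N))" if ab: "ab \<in> H\<^sub>1 \<times> H\<^sub>2" for ab
  proof -
    obtain a b where ab': "ab = (a, b)" "a \<in> H" "b \<in> H" using ab by (auto simp: H_def)
    have "(\<Sum>q\<in>R a b. (cmod (- B a b q))\<^sup>2) = (\<Sum>q\<in>R a b. (cmod (P_diff (swap_colors y a b) y q))\<^sup>2)"
      using s by (simp add: B_def norm_mult)
    also have "\<dots> \<le> 16 * real N"
      using sum_rest_le[OF unit sub ab'(2,3)] cardH by (simp add: R_def J_def)
    finally have S: "(\<Sum>q\<in>R a b. (cmod (- B a b q))\<^sup>2) \<le> 16 * real N" .
    \<comment> \<open>The parameter r / (8N) minimizes the Chernoff exponent 4 N t^2 - t r that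
      belongs to a coefficient sum of 16 N.\<close>
    have "prob (E3 ab) \<le> exp ((r / (8 * real N))\<^sup>2 * (\<Sum>q\<in>R a b. (cmod (- B a b q))\<^sup>2) / 4 - r / (8 * real N) * r)"
      unfolding E3_def ab' prod.case using r by (intro lin_upper_tail R) auto
    also have "\<dots> \<le> exp ((r / (8 * real N))\<^sup>2 * (16 * real N) / 4 - r / (8 * real N) * r)"
      unfolding exp_le_cancel_iff by (intro diff_right_mono divide_right_mono mult_left_mono S) auto
    also have "(r / (8 * real N))\<^sup>2 * (16 * real N) / 4 - r / (8 * real N) * r = - r\<^sup>2 / (16 * real N)"
      using N(3) by (simp add: field_simps power2_eq_square)
    finally show ?thesis .
  qed
  have meas: "E1 \<in> events" "E2 \<in> events" "E3 ab \<in> events" for ab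
    unfolding E1_def E2_def E3_def using fin by (auto split: prod.splits)
  have cover: "{\<omega> \<in> space M. yA \<omega> \<in> theta_class n k y} \<subseteq> E1 \<union> E2 \<union> (\<Union>ab\<in>H\<^sub>1 \<times> H\<^sub>2. E3 ab)"
  proof
    fix \<omega> assume w: "\<omega> \<in> {\<omega> \<in> space M. yA \<omega> \<in> theta_class n k y}"
    let ?U = "observation y \<sigma> (W \<omega>)"
    show "\<omega> \<in> E1 \<union> E2 \<union> (\<Union>ab\<in>H\<^sub>1 \<times> H\<^sub>2. E3 ab)"
    proof (rule ccontr)
      \<comment> \<open>Off these events some \<open>a\<close> and \<open>b\<close> have star forms
        reaching \<open>g\<close>, while the remainder of their swap exceeds -r. The swap then
        strictly beats \<open>y\<close>, against minimality of \<open>yA \<omega>\<close>.\<close>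
      assume contr: "\<omega> \<notin> E1 \<union> E2 \<union> (\<Union>ab\<in>H\<^sub>1 \<times> H\<^sub>2. E3 ab)"
      obtain a where a: "a \<in> H\<^sub>1" "g \<le> lin (A v a) (J a) \<omega>" using contr w by (force simp: E1_def)
      obtain b where b: "b \<in> H\<^sub>2" "g \<le> lin (A u b) (J b) \<omega>" using contr w by (force simp: E2_def)
      have "\<omega> \<notin> E3 (a, b)" using contr a b by blast
      hence rest: "- r < lin (B a b) (R a b) \<omega>"
        using w by (simp add: E3_def lin_uminus)
      define x where "x = swap_colors y a b"
      have ab: "a \<noteq> b" using y1(1)[OF a(1)] y2(1)[OF b(1)] uv by auto
      have x: "x \<in> Theta_A n k"
        unfolding x_def using y1 y2 a b by (intro swap_colors_in_Theta_A[OF y]) auto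
      have "lin (B a b) (pairs n) \<omega> = lin (B a b) (J a) \<omega> + lin (B a b) (J b) \<omega> + lin (B a b) (R a b) \<omega>"
      proof -
        have "pairs n = (J a \<union> J b) \<union> R a b" using J by (auto simp: R_def)
        moreover have "J a \<inter> J b = {}"
          using disjoint_star_pairs[of n H] ab y1(3)[OF a(1)] y2(3)[OF b(1)]
          by (auto simp: J_def disjoint_family_on_def)
        moreover have "(J a \<union> J b) \<inter> R a b = {}" by (auto simp: R_def)
        moreover have "finite (J a)" "finite (J b)" "finite (R a b)"
          using J R finite_pairs finite_subset by metis+
        ultimately show ?thesis by (simp add: lin_def sum.union_disjoint)
      qed
      moreover have "lin (B a b) (J a) \<omega> = lin (A v a) (J a) \<omega>"
        using P_diff_swap(1)[OF y1(3)[OF a(1)] y2(3)[OF b(1)]] y2(1)[OF b(1)]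
        unfolding lin_def A_def B_def J_def by (intro sum.cong) auto
      moreover have "lin (B a b) (J b) \<omega> = lin (A u b) (J b) \<omega>"
        using P_diff_swap(2)[OF y1(3)[OF a(1)] y2(3)[OF b(1)]] y1(1)[OF a(1)]
        unfolding lin_def A_def B_def J_def by (intro sum.cong) auto
      ultimately have "2 * g - r < lin (B a b) (pairs n) \<omega>" using a b rest by linarith
      hence "2 * \<bar>\<sigma>\<bar> * (2 * g - r) < 2 * \<bar>\<sigma>\<bar> * lin (B a b) (pairs n) \<omega>"
        using \<sigma> by (intro mult_strict_left_mono) auto
      also have "\<dots> = 2 * \<sigma> * lin (P_diff x y) (pairs n) \<omega>"
        unfolding B_def lin_scaleR x_def using s(3) by (simp add: mult_ac)
      finally have "4 * real n * c < 2 * \<sigma> * lin (P_diff x y) (pairs n) \<omega>"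
        using level by (simp add: g_def mult.assoc)
      moreover have "energy n x y \<le> 4 * real n * c"
      proof -
        have "energy n x y \<le> 2 * real n * (cmod (y a - y b))\<^sup>2"
          unfolding x_def by (intro energy_swap_le unit y1(2)[OF a(1)] y2(2)[OF b(1)])
        thus ?thesis using y1(1)[OF a(1)] y2(1)[OF b(1)] c(2) by simp
      qed
      moreover have herm: "W \<omega> b a = cnj (W \<omega> a b)" if "a \<in> {1..n}" "b \<in> {1..n}" for a b
        using W w that unfolding standard_GUE_def by blast
      have "objective n ?U x - objective n ?U y = 2 * energy n x y - 4 * \<sigma> * lin (P_diff x y) (pairs n) \<omega>"
        unfolding lin_def
        by (intro objective_diff Theta_unit[OF k Theta_A_subset[OF x]] unit herm)
      ultimately have less: "objective n ?U x < objective n ?U y" by linarith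
      have "is_arg_min (objective n ?U) (\<lambda>x. x \<in> Theta_A n k) (yA \<omega>)"
        using arg w by (auto simp: argmin_estimator_def)
      hence "objective n ?U (yA \<omega>) \<le> objective n ?U x"
        using x by (auto simp: is_arg_min_linorder)
      moreover have "objective n ?U (yA \<omega>) = objective n ?U y"
      proof (rule objective_cong)
        fix a b assume ab: "a \<in> {1..n}" "b \<in> {1..n}"
        obtain \<alpha> where "\<forall>a\<in>{1..n}. cis \<alpha> * yA \<omega> a = y a"
          using w by (auto simp: theta_class_def color_equiv_def)
        hence eq: "cis \<alpha> * yA \<omega> a = y a" "cis \<alpha> * yA \<omega> b = y b" using ab by blast+
        have "P_mat y a b = P_mat (\<lambda>a. cis \<alpha> * yA \<omega> a) a b" by (simp only: P_mat_def eq)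
        thus "P_mat (yA \<omega>) a b = P_mat y a b" by (simp only: P_mat_rotate norm_cis)
      qed
      ultimately show False using less by simp
    qed
  qed
  have "\<P>(\<omega> in M. yA \<omega> \<in> theta_class n k y) \<le> prob (E1 \<union> E2 \<union> (\<Union>ab\<in>H\<^sub>1 \<times> H\<^sub>2. E3 ab))"
    using cover meas fin by (intro finite_measure_mono) auto
  also have "\<dots> \<le> prob E1 + prob E2 + prob (\<Union>ab\<in>H\<^sub>1 \<times> H\<^sub>2. E3 ab)"
  proof -
    have "prob (E1 \<union> E2 \<union> (\<Union>ab\<in>H\<^sub>1 \<times> H\<^sub>2. E3 ab)) \<le> prob (E1 \<union> E2) + prob (\<Union>ab\<in>H\<^sub>1 \<times> H\<^sub>2. E3 ab)"
      using meas fin by (intro measure_Un_le) auto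
    moreover have "prob (E1 \<union> E2) \<le> prob E1 + prob E2"
      using meas by (intro measure_Un_le) auto
    ultimately show ?thesis by simp
  qed
  also have "prob (\<Union>ab\<in>H\<^sub>1 \<times> H\<^sub>2. E3 ab) \<le> (\<Sum>ab\<in>H\<^sub>1 \<times> H\<^sub>2. prob (E3 ab))"
    using meas fin by (intro finite_measure_subadditive_finite) auto
  also have "\<dots> \<le> (\<Sum>ab\<in>H\<^sub>1 \<times> H\<^sub>2. exp (- r\<^sup>2 / (16 * real N)))"
    by (intro sum_mono P3)
  also have "\<dots> = (real N)\<^sup>2 * exp (- r\<^sup>2 / (16 * real N))"
    using N by (simp add: card_cartesian_product power2_eq_square)
  finally show ?thesis using P1 P2 by (simp add: p_def)
qed

section \<open>Asymptotic estimates\<close>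

text \<open>The first exponent is of order n powr -d and tends to 0; in the second summand n ln n
  dominates n ln K.\<close>

lemma union_bound_tendsto_0:
  fixes K d :: real
  assumes "0 < K" "0 < d"
  shows "(\<lambda>n. exp (real n * ((K - 1) * real n powr - (1 + d))) - 1
    + exp (real n * ln K) * exp (- (d / 2) * (real n * ln (real n)))) \<longlonglongrightarrow> 0"
proof -
  have "(\<lambda>n. real n * ((K - 1) * real n powr - (1 + d))) \<longlonglongrightarrow> 0"
    using assms by real_asymp
  hence "(\<lambda>n. exp (real n * ((K - 1) * real n powr - (1 + d))) - 1) \<longlonglongrightarrow> 0"
    using tendsto_diff[OF tendsto_exp tendsto_const, of _ 0 sequentially 1] by simp
  moreover have "(\<lambda>n. exp (real n * ln K) * exp (- (d / 2) * (real n * ln (real n)))) \<longlonglongrightarrow> 0"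
  proof -
    have "filterlim (\<lambda>n. real n * (a - d / 2 * ln (real n))) at_bot sequentially" for a
      using assms by real_asymp
    from filterlim_compose[OF exp_at_bot this[of "ln K"]] show ?thesis
      by (simp add: algebra_simps flip: exp_add)
  qed
  ultimately show ?thesis using tendsto_add by fastforce
qed

text \<open>After division by n the right side tends to 4 c sqrt ((1 + \<delta>) (1 - d)), which
  exceeds 4 c. The deducted n / (K ln n) is negligible against n, and the remainder level against
  sqrt (n ln n).\<close>

lemma level_eventually:
  fixes K c \<delta> d :: real
  assumes K: "0 < K" and c: "0 < c" and \<delta>: "0 < \<delta>" and d: "d < 1" "1 < (1 + \<delta>) * (1 - d)"
  shows "\<forall>\<^sub>F n in sequentially. 4 * real n * c \<le> 2 * sqrt ((1 + \<delta>) * real n * c / (2 * ln (real n))) *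
    (2 * sqrt (2 * (1 - d) * ln (real n)) * sqrt (c * (real n - 2 * (real n / (K * ln (real n)))))
      - sqrt (real n) * ln (real n) powr (1/4))"
proof -
  define D where "D = 1 - d"
  define L where "L = (1 + \<delta>) * c / 2"
  have D: "0 < D" "0 < L" using d c \<delta> by (auto simp: D_def L_def)
  have "((\<lambda>n. 2 * sqrt (L * real n / ln (real n)) *
    (2 * sqrt (2 * D * ln (real n)) * sqrt (c * (real n - 2 * (real n / (K * ln (real n)))))
      - sqrt (real n) * ln (real n) powr (1/4)) / real n) \<longlongrightarrow> 2 * sqrt L * (2 * sqrt (2 * D) * sqrt c)) sequentially"
  proof -
    have lim: "((\<lambda>n. 2 * sqrt (L * real n / ln (real n)) *
      (2 * sqrt (2 * D * ln (real n)) * sqrt (c * (real n - 2 * (real n / (K * ln (real n)))))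
        - sqrt (real n) * ln (real n) powr (1/4)) / real n)
      \<longlongrightarrow> 4 * (L powr (1/2) * ((2 * D) powr (1/2) * c powr (1/2)))) sequentially"
      using D K c by real_asymp
    have "4 * (L powr (1/2) * ((2 * D) powr (1/2) * c powr (1/2))) = 2 * sqrt L * (2 * sqrt (2 * D) * sqrt c)"
      using D c by (simp add: powr_half_sqrt)
    with lim show ?thesis by simp
  qed
  moreover have "4 * c < 2 * sqrt L * (2 * sqrt (2 * D) * sqrt c)"
  proof -
    have "2 * sqrt L * (2 * sqrt (2 * D) * sqrt c) = 4 * sqrt (L * (2 * D) * c)"
      using D c by (simp add: real_sqrt_mult)
    also have "L * (2 * D) * c = c\<^sup>2 * ((1 + \<delta>) * (1 - d))"
      by (simp add: L_def D_def power2_eq_square)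
    also have "sqrt \<dots> = c * sqrt ((1 + \<delta>) * (1 - d))" using c by (simp add: real_sqrt_mult)
    finally show ?thesis using d c by simp
  qed
  ultimately have "\<forall>\<^sub>F n in sequentially. 4 * c < 2 * sqrt (L * real n / ln (real n)) *
    (2 * sqrt (2 * D * ln (real n)) * sqrt (c * (real n - 2 * (real n / (K * ln (real n)))))
      - sqrt (real n) * ln (real n) powr (1/4)) / real n"
    by (rule order_tendstoD(1))
  thus ?thesis using eventually_gt_at_top[of 0]
  proof eventually_elim
    case (elim n)
    have "L * real n / ln (real n) = (1 + \<delta>) * real n * c / (2 * ln (real n))" by (simp add: L_def)
    thus ?case using elim by (simp add: D_def pos_less_divide_eq mult_ac)
  qed
qed

text \<open>About n / (K ln n) trials succeed with probability n powr - (1 - d) up to subpolynomial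
  factors. The expected number of successes is thus n powr d up to such factors and tends to
  infinity.\<close>

lemma missed_maximum_tendsto_0:
  fixes K d :: real
  assumes "0 < K" "0 < d" "d < 1"
  shows "(\<lambda>n. exp (- (exp (- (sqrt (2 * (1 - d) * ln (real n)) + 1)\<^sup>2 / 2) / sqrt (2 * pi)
      * (real n / (K * ln (real n)) - 1)))) \<longlonglongrightarrow> 0"
proof -
  define D where "D = 1 - d"
  have D: "0 < D" using assms by (simp add: D_def)
  \<comment> \<open>The same exponent with the square expanded and the factor n moved into the
    exponential, where the growth n powr d is visible.\<close>
  let ?h = "\<lambda>n::nat. exp (d * ln (real n) - sqrt (2 * D * ln (real n)) - 1 / 2) * (1 / (K * ln (real n)) - 1 / real n)
    / sqrt (2 * pi)"
  have "filterlim (\<lambda>n. - ?h n) at_bot sequentially"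
    using assms D by real_asymp
  hence lim: "(\<lambda>n. exp (- ?h n)) \<longlonglongrightarrow> 0" by (rule filterlim_compose[OF exp_at_bot])
  have "\<forall>\<^sub>F n in sequentially. exp (- ?h n) = exp (- (exp (- (sqrt (2 * D * ln (real n)) + 1)\<^sup>2 / 2) / sqrt (2 * pi)
      * (real n / (K * ln (real n)) - 1)))"
    using eventually_gt_at_top[of 1]
  proof eventually_elim
    case (elim n)
    have "(sqrt (2 * D * ln (real n)) + 1)\<^sup>2 = 2 * D * ln (real n) + 2 * sqrt (2 * D * ln (real n)) + 1"
      using D elim by (simp add: power2_sum)
    hence "d * ln (real n) - sqrt (2 * D * ln (real n)) - 1 / 2
        = - (sqrt (2 * D * ln (real n)) + 1)\<^sup>2 / 2 + ln (real n)"
      by (simp add: D_def field_simps)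
    hence "exp (d * ln (real n) - sqrt (2 * D * ln (real n)) - 1 / 2)
        = exp (- (sqrt (2 * D * ln (real n)) + 1)\<^sup>2 / 2) * real n"
      using elim by (simp only: exp_add exp_ln)
    thus ?case using elim by (simp add: algebra_simps)
  qed
  with lim show ?thesis unfolding D_def[symmetric] by (rule Lim_transform_eventually)
qed

text \<open>The exponent equals - (K / 16) (ln n) powr (3/2), which beats the factor n^2 = exp (2 ln
  n).\<close>

lemma remainder_tendsto_0:
  fixes K :: real
  assumes "0 < K"
  shows "(\<lambda>n. (real n)\<^sup>2 * exp (- (sqrt (real n) * ln (real n) powr (1/4))\<^sup>2 * (K * ln (real n)) / (16 * real n)))
    \<longlonglongrightarrow> 0"
  using assms by real_asymp

section \<open>The threshold\<close>

lemma one_minus_cos_pos: "k \<ge> 2 \<Longrightarrow> 0 < 1 - cos (2 * pi / real k)"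
  using cos_monotone_0_pi[of 0 "2 * pi / real k"] by (simp add: field_simps)

lemma aligned_sum_le:
  assumes k: "k \<ge> 2" and n: "n \<ge> 2" and y: "y \<in> Theta n k" and \<delta>: "0 < \<delta>" "\<delta> \<le> 1 / 2"
    and s: "s = (1 - \<delta>) * real n * (1 - cos (2 * pi / real k)) / (2 * ln (real n))"
  shows "(\<Sum>x\<in>{x \<in> Theta n k. x \<noteq> y \<and> aligned n x y}. exp (- energy n x y / (4 * s)))
    \<le> exp (real n * ((real k - 1) * real n powr - (1 + \<delta> / 2))) - 1
      + exp (real n * ln (real k)) * exp (- (\<delta> / 2 / 2) * (real n * ln (real n)))"
proof -
  have k0: "k > 0" using k by simp
  define c where "c = 1 - cos (2 * pi / real k)"
  define l where "l = ln (real n)"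
  define g where "g = real n powr - (1 + \<delta> / 2)"
  define h where "h = exp (- (\<delta> / 2 / 2) * (real n * ln (real n)))"
  have c: "0 < c" using one_minus_cos_pos[OF k] by (simp add: c_def)
  have l: "0 < l" using n by (simp add: l_def)
  have gh: "0 \<le> g" "0 \<le> h" by (simp_all add: g_def h_def)
  have gexp: "g = exp (- ((1 + \<delta> / 2) * l))" using n by (simp add: g_def l_def powr_def algebra_simps)
  have scale: "e / (4 * s) = e * l / (2 * (1 - \<delta>) * real n * c)" for e
  proof -
    have "4 * s = 2 * (1 - \<delta>) * real n * c / l" by (simp add: s c_def l_def)
    thus ?thesis by simp
  qed
  \<comment> \<open>Adding the bounds for few and for many mismatches gives one estimate for every
    competitor, so the sum itself need not be split.\<close>
  have each: "exp (- energy n x y / (4 * s)) \<le> g ^ mismatches n x y + h"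
    if x: "x \<in> Theta n k" "aligned n x y" for x
  proof -
    define m where "m = real (mismatches n x y)"
    have m: "0 \<le> m" by (simp add: m_def)
    show ?thesis
    proof (cases "m \<le> \<delta> / 2 * real n")
      case True
      \<comment> \<open>The slack \<delta> pays both for the loss n - m \<ge> (1 - \<delta>/2) n and
        for the surplus \<delta>/2 in the exponent of \<open>g\<close>.\<close>
      have "(1 + \<delta> / 2) * (1 - \<delta>) \<le> 1 - \<delta> / 2" using \<delta> by (simp add: algebra_simps)
      hence "(1 + \<delta> / 2) * (1 - \<delta>) * (2 * c * m * real n) \<le> (1 - \<delta> / 2) * (2 * c * m * real n)"
        using c m by (intro mult_right_mono) auto
      also have "\<dots> = 2 * c * m * (real n - \<delta> / 2 * real n)" by (simp add: algebra_simps)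
      also have "\<dots> \<le> 2 * c * m * (real n - m)" using True c m by (intro mult_left_mono) auto
      also have "\<dots> \<le> energy n x y" using energy_ge_small[OF k0 x(1) y] by (simp add: c_def m_def)
      finally have "(1 + \<delta> / 2) * (1 - \<delta>) * (2 * c * m * real n) * l \<le> energy n x y * l"
        using l by (intro mult_right_mono) auto
      hence "(1 + \<delta> / 2) * m * l * (2 * (1 - \<delta>) * real n * c) \<le> energy n x y * l"
        by (simp only: mult_ac)
      hence "(1 + \<delta> / 2) * m * l \<le> energy n x y * l / (2 * (1 - \<delta>) * real n * c)"
        using \<delta> n c by (subst pos_le_divide_eq) auto
      hence "exp (- energy n x y / (4 * s)) \<le> exp (- ((1 + \<delta> / 2) * m * l))"
        using scale[of "energy n x y"] by simp
      also have "\<dots> = g ^ mismatches n x y"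
        unfolding gexp m_def by (simp add: mult_ac flip: exp_of_nat_mult)
      finally show ?thesis using gh by simp
    next
      case False
      have "\<delta> / 2 / 2 * real n * (2 * (1 - \<delta>) * real n * c) \<le> (\<delta> / 2 * real n) * (1 * real n * c)"
        using \<delta> c by (simp add: mult_left_mono mult_right_mono)
      also have "\<dots> \<le> m * (1 * real n * c)" using False c by (intro mult_right_mono) auto
      also have "\<dots> \<le> energy n x y" using energy_ge_aligned[OF k0 x(1) y x(2)] by (simp add: c_def m_def mult_ac)
      finally have "\<delta> / 2 / 2 * real n * (2 * (1 - \<delta>) * real n * c) * l \<le> energy n x y * l"
        using l by (intro mult_right_mono) auto
      hence "\<delta> / 2 / 2 * real n * l * (2 * (1 - \<delta>) * real n * c) \<le> energy n x y * l"
        by (simp only: mult_ac)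
      hence "\<delta> / 2 / 2 * real n * l \<le> energy n x y * l / (2 * (1 - \<delta>) * real n * c)"
        using \<delta> n c by (subst pos_le_divide_eq) auto
      hence "exp (- energy n x y / (4 * s)) \<le> h"
        using scale[of "energy n x y"] by (simp add: h_def l_def mult_ac)
      thus ?thesis using gh by (simp add: add_increasing)
    qed
  qed
  let ?X = "{x \<in> Theta n k. x \<noteq> y \<and> aligned n x y}"
  have fin: "finite (Theta n k)" by (rule finite_Theta[OF k0])
  have "(\<Sum>x\<in>?X. exp (- energy n x y / (4 * s))) \<le> (\<Sum>x\<in>?X. g ^ mismatches n x y + h)"
    by (intro sum_mono each) auto
  also have "\<dots> \<le> (\<Sum>x\<in>Theta n k - {y}. g ^ mismatches n x y + h)"
    using fin gh by (intro sum_mono2) auto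
  also have "\<dots> = (\<Sum>x\<in>Theta n k - {y}. g ^ mismatches n x y) + real (card (Theta n k - {y})) * h"
    by (simp add: sum.distrib)
  also have "(\<Sum>x\<in>Theta n k - {y}. g ^ mismatches n x y) = (\<Sum>x\<in>Theta n k. g ^ mismatches n x y) - 1"
    using fin y by (simp add: sum_diff1 mismatches_def)
  also have "\<dots> = (1 + (real k - 1) * g) ^ n - 1" by (simp add: sum_power_mismatches[OF k0 y])
  also have "(1 + (real k - 1) * g) ^ n \<le> exp ((real k - 1) * g) ^ n"
    using gh k by (intro power_mono exp_ge_add_one_self) auto
  also have "\<dots> = exp (real n * ((real k - 1) * g))" by (simp add: exp_of_nat_mult)
  also have "real (card (Theta n k - {y})) * h \<le> real (card (Theta n k)) * h"
    using gh fin by (intro mult_right_mono of_nat_mono card_mono) auto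
  also have "real (card (Theta n k)) = real k ^ n"
    by (simp add: Theta_def card_PiE card_colors[OF k0])
  also have "\<dots> = exp (real n * ln (real k))" using k by (simp add: exp_of_nat_mult)
  finally show ?thesis by (simp add: g_def h_def)
qed

lemma recovery_bound_asymptotic:
  assumes M: "prob_space M" and W: "standard_GUE M n W" and k: "k \<ge> 2" and n: "n \<ge> 3"
    and y: "y \<in> Theta_A n k" and arg: "argmin_estimator M n k (\<lambda>\<omega>. observation y \<sigma> (W \<omega>)) yA"
    and large: "real k * ln (real n) \<le> real n"
    and c: "c = 1 - cos (2 * pi / real k)"
    and t: "0 \<le> t" and r: "0 \<le> r" and q: "0 < q" "q < \<sigma>\<^sup>2"
    and level: "4 * real n * c \<le> 2 * sqrt q *
      (2 * t * sqrt (c * (real n - 2 * (real n / (real k * ln (real n))))) - r)"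
  shows "\<P>(\<omega> in M. yA \<omega> \<in> theta_class n k y)
    \<le> 2 * exp (- (exp (- (t + 1)\<^sup>2 / 2) / sqrt (2 * pi) * (real n / (real k * ln (real n)) - 1)))
      + (real n)\<^sup>2 * exp (- r\<^sup>2 * (real k * ln (real n)) / (16 * real n))"
proof -
  have k0: "k > 0" using k by simp
  have c0: "0 < c" using one_minus_cos_pos[OF k] by (simp add: c)
  have l: "1 < ln (real n)"
  proof -
    have "exp 1 < real n" using e_less_272 n by linarith
    hence "ln (exp 1) < ln (real n)" using n by (subst ln_less_cancel_iff) auto
    thus ?thesis by simp
  qed
  \<comment> \<open>A choice of size n / (k ln n) leaves almost n candidates up to a logarithm,
    while the remainder variance O(N) is o(n). Since ln n > 1 for n \<ge> 3, it fits into a color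
    class of size n / k.\<close>
  define z where "z = real n / (real k * ln (real n))"
  define N where "N = nat \<lfloor>z\<rfloor>"
  have kl: "0 < real k * ln (real n)" "2 < real k * ln (real n)"
    using k l mult_strict_mono'[of 1 "ln (real n)" 2 "real k"] mult_le_less_imp_less[of 2 "real k" 1 "ln (real n)"]
    by auto
  have z1: "1 \<le> z" using large kl by (simp add: z_def)
  have N: "real N \<le> z" "z - 1 \<le> real N" "0 < N"
    using z1 by (auto simp: N_def le_nat_iff)
  have "2 * z < real n" using kl n by (simp add: z_def field_simps)
  hence N2: "2 * N < n" using N by linarith
  have zk: "z \<le> real n / real k"
    using l k n unfolding z_def by (intro divide_left_mono) auto
  have cardc: "real (card {a\<in>{1..n}. y a = cis (angle k j)}) = real n / real k" if "j \<in> {1..k}" for j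
    using y that by (simp add: Theta_A_def)
  have le: "N \<le> card {a\<in>{1..n}. y a = cis (angle k 1)}" "N \<le> card {a\<in>{1..n}. y a = cis (angle k 2)}"
    using cardc[of 1] cardc[of 2] k N(1) zk by auto
  obtain H\<^sub>1 where H1: "H\<^sub>1 \<subseteq> {a\<in>{1..n}. y a = cis (angle k 1)}" "card H\<^sub>1 = N"
    by (rule obtain_subset_with_card_n[OF le(1)])
  obtain H\<^sub>2 where H2: "H\<^sub>2 \<subseteq> {a\<in>{1..n}. y a = cis (angle k 2)}" "card H\<^sub>2 = N"
    by (rule obtain_subset_with_card_n[OF le(2)])
  have dist: "(cmod (cis (angle k 1) - cis (angle k 2)))\<^sup>2 = 2 * c"
    using norm_cis_diff_one[of "2 * pi / real k"] by (simp add: angle_def c norm_minus_commute)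
  define g0 where "g0 = 2 * t * sqrt (c * (real n - 2 * z)) - r"
  define g where "g = 2 * t * sqrt (c * (real n - 2 * real N)) - r"
  have g0g: "g0 \<le> g"
    unfolding g0_def g_def using N t c0
    by (intro diff_right_mono mult_left_mono real_sqrt_le_mono) auto
  have lev0: "4 * real n * c \<le> 2 * sqrt q * g0" using level by (simp add: g0_def z_def)
  \<comment> \<open>Nonnegativity follows from the positive left side of \<open>level\<close>. It
    permits replacing sqrt q by |\<sigma>| and \<open>g0\<close> by \<open>g\<close>
    simultaneously.\<close>
  have g0: "0 \<le> g0"
  proof (rule ccontr)
    assume "\<not> 0 \<le> g0"
    hence "2 * sqrt q * g0 \<le> 0" using q by (simp add: mult_nonneg_nonpos)
    moreover have "0 < 4 * real n * c" using c0 n by simp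
    ultimately show False using lev0 by linarith
  qed
  have "sqrt q \<le> \<bar>\<sigma>\<bar>" using q by (metis less_imp_le real_sqrt_abs real_sqrt_le_mono)
  hence "2 * sqrt q * g0 \<le> 2 * \<bar>\<sigma>\<bar> * g" using g0 g0g q by (intro mult_mono) auto
  with lev0 have lev: "4 * real n * c \<le> 2 * \<bar>\<sigma>\<bar> * g" by linarith
  have \<sigma>0: "\<sigma> \<noteq> 0" using q by auto
  define p where "p = exp (- (t + 1)\<^sup>2 / 2) / sqrt (2 * pi)"
  have p: "0 \<le> p" "p \<le> 1"
  proof -
    have "1 \<le> sqrt (2 * pi)" using pi_gt3 by (intro real_le_rsqrt) auto
    moreover have "exp (- (t + 1)\<^sup>2 / 2) \<le> 1" by simp
    ultimately have "exp (- (t + 1)\<^sup>2 / 2) \<le> sqrt (2 * pi)" by linarith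
    thus "p \<le> 1" by (simp add: p_def)
  qed (simp add: p_def)
  have "\<P>(\<omega> in M. yA \<omega> \<in> theta_class n k y)
      \<le> 2 * (1 - p) ^ N + (real N)\<^sup>2 * exp (- r\<^sup>2 / (16 * real N))"
    unfolding p_def using lev unfolding g_def
    by (intro recovery_bound[OF M W k0 y arg H1(1) H2(1) H1(2) H2(2) N(3) N2 c0 dist t r \<sigma>0])
  also have "(1 - p) ^ N \<le> exp (- (p * (z - 1)))"
  proof -
    have "(1 - p) ^ N \<le> exp (- p) ^ N"
      using p exp_ge_add_one_self[of "- p"] by (intro power_mono) auto
    also have "\<dots> = exp (- (p * real N))" by (simp add: mult.commute flip: exp_of_nat_mult)
    also have "\<dots> \<le> exp (- (p * (z - 1)))" using p N by (simp add: mult_left_mono)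
    finally show ?thesis .
  qed
  also have "(real N)\<^sup>2 * exp (- r\<^sup>2 / (16 * real N))
      \<le> (real n)\<^sup>2 * exp (- r\<^sup>2 * (real k * ln (real n)) / (16 * real n))"
  proof (intro mult_mono power_mono)
    have "r\<^sup>2 / (16 * z) \<le> r\<^sup>2 / (16 * real N)" using N by (intro divide_left_mono) auto
    moreover have "r\<^sup>2 / (16 * z) = r\<^sup>2 * (real k * ln (real n)) / (16 * real n)"
      using kl n by (simp add: z_def)
    ultimately show "exp (- r\<^sup>2 / (16 * real N)) \<le> exp (- r\<^sup>2 * (real k * ln (real n)) / (16 * real n))"
      by simp
  qed (use N2 in auto)
  finally show ?thesis by (simp add: p_def z_def)
qed

lemma eventually_at_top_multiples:
  assumes "eventually P sequentially"
  shows "\<forall>\<^sub>F n in at_top_multiples k. P n \<and> n > 0 \<and> k dvd n"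
proof -
  have "eventually (\<lambda>n. P n \<and> n > 0) sequentially"
    using assms eventually_gt_at_top[of 0] by eventually_elim auto
  thus ?thesis unfolding at_top_multiples_def eventually_inf_principal
    by eventually_elim auto
qed

lemma tendsto_at_top_multiples: "f \<longlonglongrightarrow> l \<Longrightarrow> (f \<longlongrightarrow> l) (at_top_multiples k)"
  unfolding at_top_multiples_def by (rule tendsto_mono[OF inf_le1])

theorem theorem2p4:
  fixes k :: nat
    and M :: "nat \<Rightarrow> 'w measure"
    and W :: "nat \<Rightarrow> 'w \<Rightarrow> nat \<Rightarrow> nat \<Rightarrow> complex"
    and y :: "nat \<Rightarrow> nat \<Rightarrow> complex"
    and \<sigma> :: "nat \<Rightarrow> real"
    and yA :: "nat \<Rightarrow> 'w \<Rightarrow> nat \<Rightarrow> complex"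
  assumes "k \<ge> 2"
    and "\<And>n. n > 0 \<Longrightarrow> k dvd n \<Longrightarrow> y n \<in> Theta_A n k"
    and "\<And>n. n > 0 \<Longrightarrow> k dvd n \<Longrightarrow> prob_space (M n)"
    and "\<And>n. n > 0 \<Longrightarrow> k dvd n \<Longrightarrow> standard_GUE (M n) n (W n)"
    and "\<And>n. n > 0 \<Longrightarrow> k dvd n \<Longrightarrow>
           argmin_estimator (M n) n k (\<lambda>\<omega>. observation (y n) (\<sigma> n) (W n \<omega>)) (yA n)"
  shows "((\<exists>\<delta>>0. \<forall>\<^sub>F n in at_top_multiples k.
             (\<sigma> n)\<^sup>2 < (1 - \<delta>) * real n * (1 - cos (2 * pi / real k)) / (2 * ln (real n)))
          \<longrightarrow> ((\<lambda>n. \<P>(\<omega> in M n. yA n \<omega> \<in> theta_class n k (y n))) \<longlongrightarrow> 1) (at_top_multiples k))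
       \<and> ((\<exists>\<delta>>0. \<forall>\<^sub>F n in at_top_multiples k.
             (\<sigma> n)\<^sup>2 > (1 + \<delta>) * real n * (1 - cos (2 * pi / real k)) / (2 * ln (real n)))
          \<longrightarrow> ((\<lambda>n. \<P>(\<omega> in M n. yA n \<omega> \<in> theta_class n k (y n))) \<longlongrightarrow> 0) (at_top_multiples k))"
proof -
  define c where "c = 1 - cos (2 * pi / real k)"
  have c: "0 < c" using one_minus_cos_pos[OF assms(1)] by (simp add: c_def)
  have k0: "k > 0" using assms(1) by simp
  let ?P = "\<lambda>n. \<P>(\<omega> in M n. yA n \<omega> \<in> theta_class n k (y n))"
  have recovery: "(?P \<longlongrightarrow> 1) (at_top_multiples k)"
    if \<delta>: "0 < \<delta>" and below: "\<forall>\<^sub>F n in at_top_multiples k. (\<sigma> n)\<^sup>2 < (1 - \<delta>) * real n * c / (2 * ln (real n))" for \<delta>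
  proof -
    \<comment> \<open>Shrinking the gap to at most 1/2 only weakens the upper bound on \<sigma>^2,
      and it keeps 1 - \<epsilon> positive.\<close>
    define \<epsilon> where "\<epsilon> = min \<delta> (1 / 2)"
    have \<epsilon>: "0 < \<epsilon>" "\<epsilon> \<le> 1 / 2" "\<epsilon> \<le> \<delta>" using \<delta> by (auto simp: \<epsilon>_def)
    define B where "B = (\<lambda>n. exp (real n * ((real k - 1) * real n powr - (1 + \<epsilon> / 2))) - 1
      + exp (real n * ln (real k)) * exp (- (\<epsilon> / 2 / 2) * (real n * ln (real n))))"
    have "B \<longlonglongrightarrow> 0" unfolding B_def using \<epsilon> k0 by (intro union_bound_tendsto_0) auto
    hence "((\<lambda>n. 1 - B n) \<longlongrightarrow> 1 - 0) (at_top_multiples k)"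
      by (intro tendsto_diff tendsto_const tendsto_at_top_multiples)
    hence lim: "((\<lambda>n. 1 - B n) \<longlongrightarrow> 1) (at_top_multiples k)" by simp
    have "\<forall>\<^sub>F n in at_top_multiples k. 1 - B n \<le> ?P n \<and> ?P n \<le> 1"
      using eventually_at_top_multiples[OF eventually_ge_at_top[of 2]] below
    proof eventually_elim
      case (elim n)
      hence n: "n \<ge> 2" "n > 0" "k dvd n" by auto
      define s where "s = (1 - \<epsilon>) * real n * c / (2 * ln (real n))"
      have "(1 - \<delta>) * real n * c / (2 * ln (real n)) \<le> s"
        unfolding s_def using \<epsilon> c n by (intro divide_right_mono mult_right_mono) auto
      hence s: "0 < s" "(\<sigma> n)\<^sup>2 \<le> s" using \<epsilon> c n elim by (auto simp: s_def)
      have "1 - B n \<le> ?P n"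
        using misclassification_bound[OF assms(3,4)[OF n(2,3)] k0 n(2) assms(2,5)[OF n(2,3)] s]
          aligned_sum_le[OF assms(1) n(1) Theta_A_subset[OF assms(2)[OF n(2,3)]] \<epsilon>(1,2) s_def[unfolded c_def]]
        by (simp add: B_def)
      moreover have "?P n \<le> 1" using assms(3)[OF n(2,3)] by (simp add: prob_space.prob_le_1)
      ultimately show ?case by simp
    qed
    thus ?thesis
      by (intro tendsto_sandwich[OF _ _ lim tendsto_const]) (auto elim: eventually_mono)
  qed
  have failure: "(?P \<longlongrightarrow> 0) (at_top_multiples k)"
    if \<delta>: "0 < \<delta>" and above: "\<forall>\<^sub>F n in at_top_multiples k. (\<sigma> n)\<^sup>2 > (1 + \<delta>) * real n * c / (2 * ln (real n))" for \<delta>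
  proof -
    \<comment> \<open>This choice gives (1 + \<delta>) (1 - d) = 1 + \<delta>/2, so lowering the
      level of the maxima by the factor sqrt (1 - d) still leaves room.\<close>
    define d where "d = \<delta> / (2 * (1 + \<delta>))"
    have "(1 + \<delta>) * d = \<delta> / 2" using \<delta> by (simp add: d_def field_simps)
    hence d: "0 < d" "d < 1" "1 < (1 + \<delta>) * (1 - d)"
      using \<delta> by (auto simp: d_def right_diff_distrib)
    define t where "t = (\<lambda>n. sqrt (2 * (1 - d) * ln (real n)))"
    \<comment> \<open>The power 1/4 keeps \<open>r n\<close> below the order sqrt (n ln n) of the
      star maxima, yet large enough to control all N^2 remainders.\<close>
    define r where "r = (\<lambda>n. sqrt (real n) * ln (real n) powr (1/4))"
    define B where "B = (\<lambda>n. 2 * exp (- (exp (- (t n + 1)\<^sup>2 / 2) / sqrt (2 * pi) * (real n / (real k * ln (real n)) - 1)))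
      + (real n)\<^sup>2 * exp (- (r n)\<^sup>2 * (real k * ln (real n)) / (16 * real n)))"
    have "B \<longlonglongrightarrow> 2 * 0 + 0"
      unfolding B_def t_def r_def using d k0
      by (intro tendsto_add tendsto_mult tendsto_const missed_maximum_tendsto_0 remainder_tendsto_0) auto
    hence lim: "(B \<longlongrightarrow> 0) (at_top_multiples k)" by (intro tendsto_at_top_multiples) simp
    have "\<forall>\<^sub>F n in sequentially. real k * ln (real n) \<le> real n"
      using k0 by real_asymp
    moreover have "\<forall>\<^sub>F n in sequentially. 4 * real n * c \<le> 2 * sqrt ((1 + \<delta>) * real n * c / (2 * ln (real n))) *
        (2 * t n * sqrt (c * (real n - 2 * (real n / (real k * ln (real n))))) - r n)"
      unfolding t_def r_def using k0 c \<delta> d by (intro level_eventually) auto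
    ultimately have "\<forall>\<^sub>F n in sequentially. n \<ge> 3 \<and> real k * ln (real n) \<le> real n \<and>
        4 * real n * c \<le> 2 * sqrt ((1 + \<delta>) * real n * c / (2 * ln (real n))) *
        (2 * t n * sqrt (c * (real n - 2 * (real n / (real k * ln (real n))))) - r n)"
      using eventually_ge_at_top[of 3] by eventually_elim auto
    from eventually_at_top_multiples[OF this] above
    have "\<forall>\<^sub>F n in at_top_multiples k. 0 \<le> ?P n \<and> ?P n \<le> B n"
    proof eventually_elim
      case (elim n)
      hence n: "n \<ge> 3" "n > 0" "k dvd n" by auto
      have q: "0 < (1 + \<delta>) * real n * c / (2 * ln (real n))" using \<delta> c n by simp
      have tr: "0 \<le> t n" "0 \<le> r n" using d n by (auto simp: t_def r_def)
      have "?P n \<le> B n"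
        unfolding B_def using elim
        by (intro recovery_bound_asymptotic[OF assms(3,4)[OF n(2,3)] assms(1) n(1) assms(2,5)[OF n(2,3)] _ c_def tr q])
          auto
      thus ?case by simp
    qed
    thus ?thesis
      by (intro tendsto_sandwich[OF _ _ tendsto_const lim]) (auto elim: eventually_mono)
  qed
  show ?thesis using recovery failure unfolding c_def by blast
qed

end
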